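(* Let $\mathcal{S}$ and $\mathcal{T}$ be triangulated categories with countable direct sums, and let $E\colon\mathcal{S}\to\mathcal{T}$ and $F\colon\mathcal{T}\to\mathcal{S}$ be exact functors compatible with countable direct sums, with natural isomorphisms $\mathcal{S}(A,FB)\simeq\mathcal{T}(EA,B)$ for $A\in\mathcal{S}$, $B\in\mathcal{T}$. Put $\mathcal{I}=\ker F$ and $L=EF\colon\mathcal{T}\to\mathcal{T}$. Then any $A\in\mathcal{T}$ admits an $\mathcal{I}$-projective resolution $P_\bullet$ consisting of $P_n=L^{n+1}A$ ($n\ge0$). Moreover, the pair of subcategories $(\langle E\mathcal{S}\rangle,\mathcal{N}_{\mathcal{I}})$ of $\mathcal{T}$ is complementary.
   Context: $\ker F$ is the system of morphisms $\mathcal{I}(A,B)=\ker(F\colon\mathcal{T}(A,B)\to\mathcal{S}(FA,FB))$. An object $P\in\mathcal{T}$ is $\mathcal{I}$-projective if $\mathcal{I}(P,A)=0$ for all $A\in\mathcal{T}$. An object $N$ is $\mathcal{I}$-contractible if $\mathrm{id}_N\in\mathcal{I}(N,N)$ (equivalently $FN\simeq0$); $\mathcal{N}_{\mathcal{I}}$ is the full subcategory of $\mathcal{I}$-contractible objects. An $\mathcal{I}$-projective resolution of $A$ is a chain complex $\cdots\to P_n\xrightarrow{\delta_n}\cdots\xrightarrow{\delta_1}P_0\xrightarrow{\delta_0}A$ in $\mathcal{T}$ with each $P_n$ $\mathcal{I}$-projective and such that $\cdots\to F(P_1)\to F(P_0)\to F(A)\to0$ is split exact, i.e. contractible by a chain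 homotopy in $\mathcal{S}$. $\langle E\mathcal{S}\rangle$ is the localizing subcategory of $\mathcal{T}$ generated by the objects $EA$, $A\in\mathcal{S}$: the smallest triangulated subcategory containing these objects and closed under countable direct sums (triangulated subcategories are closed under isomorphism). A subcategory is thick if it is closed under direct summands. A pair $(\mathcal{L},\mathcal{N})$ of thick triangulated subcategories of $\mathcal{T}$ is complementary if $\mathcal{T}(P,N)=0$ for all $P\in\mathcal{L}$, $N\in\mathcal{N}$, and for every $A\in\mathcal{T}$ there is an exact triangle $P_A\to A\to N_A\to\Sigma P_A$ with $P_A\in\mathcal{L}$ and $N_A\in\mathcal{N}$. *)

theory Defs
  imports "HOL-Algebra.Group"
begin

section \<open>Categories and additive categories\<close>

record ('o, 'm) cat =
  Obj  :: "'o set"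
  Arr  :: "'m set"
  Dom  :: "'m \<Rightarrow> 'o"
  Cod  :: "'m \<Rightarrow> 'o"
  Ident :: "'o \<Rightarrow> 'm"
  Comp :: "'m \<Rightarrow> 'm \<Rightarrow> 'm"  (infixr "\<cdot>\<index>" 70)

definition Hom :: "('o, 'm, 'z) cat_scheme \<Rightarrow> 'o \<Rightarrow> 'o \<Rightarrow> 'm set" where
  "Hom C A B = {f \<in> Arr C. Dom C f = A \<and> Cod C f = B}"

locale category =
  fixes C :: "('o, 'm, 'z) cat_scheme" (structure)
  assumes Dom_in_Obj: "f \<in> Arr C \<Longrightarrow> Dom C f \<in> Obj C"
    and Cod_in_Obj: "f \<in> Arr C \<Longrightarrow> Cod C f \<in> Obj C"
    and Id_in_Hom: "A \<in> Obj C \<Longrightarrow> Ident C A \<in> Hom C A A"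
    and Comp_in_Hom: "\<lbrakk>f \<in> Hom C X Y; g \<in> Hom C Y Z\<rbrakk> \<Longrightarrow> g \<cdot> f \<in> Hom C X Z"
    and Comp_assoc: "\<lbrakk>f \<in> Hom C W X; g \<in> Hom C X Y; h \<in> Hom C Y Z\<rbrakk>
          \<Longrightarrow> (h \<cdot> g) \<cdot> f = h \<cdot> (g \<cdot> f)"
    and Comp_Id_left: "f \<in> Hom C X Y \<Longrightarrow> Ident C Y \<cdot> f = f"
    and Comp_Id_right: "f \<in> Hom C X Y \<Longrightarrow> f \<cdot> Ident C X = f"

definition iso_arrow :: "('o, 'm, 'z) cat_scheme \<Rightarrow> 'o \<Rightarrow> 'o \<Rightarrow> 'm \<Rightarrow> bool" where
  "iso_arrow C A B f \<longleftrightarrow>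
     f \<in> Hom C A B \<and>
     (\<exists>g \<in> Hom C B A. g \<cdot>\<^bsub>C\<^esub> f = Ident C A \<and> f \<cdot>\<^bsub>C\<^esub> g = Ident C B)"

definition zero_object :: "('o, 'm, 'z) cat_scheme \<Rightarrow> 'o \<Rightarrow> bool" where
  "zero_object C Z \<longleftrightarrow>
     Z \<in> Obj C \<and> (\<forall>A \<in> Obj C. (\<exists>!f. f \<in> Hom C Z A) \<and> (\<exists>!f. f \<in> Hom C A Z))"

text \<open>\<open>S\<close> together with the maps \<open>j k : A k \<rightarrow> S\<close> (\<open>k \<in> I\<close>) is a coproduct
  (direct sum) of the family \<open>A\<close>; only the values of \<open>A\<close> and \<open>j\<close> on \<open>I\<close> matter.\<close>

definition is_coproduct ::
  "('o, 'm, 'z) cat_scheme \<Rightarrow> 'i set \<Rightarrow> ('i \<Rightarrow> 'o) \<Rightarrow> 'o \<Rightarrow> ('i \<Rightarrow> 'm) \<Rightarrow> bool" where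
  "is_coproduct C I A S j \<longleftrightarrow>
     S \<in> Obj C \<and> (\<forall>k \<in> I. j k \<in> Hom C (A k) S) \<and>
     (\<forall>B \<in> Obj C. \<forall>f. (\<forall>k \<in> I. f k \<in> Hom C (A k) B) \<longrightarrow>
        (\<exists>!h. h \<in> Hom C S B \<and> (\<forall>k \<in> I. h \<cdot>\<^bsub>C\<^esub> j k = f k)))"

text \<open>Every countable index set is in bijection with a set of natural numbers.\<close>

definition has_countable_sums :: "('o, 'm, 'z) cat_scheme \<Rightarrow> bool" where
  "has_countable_sums C \<longleftrightarrow>
     (\<forall>(I :: nat set) A. (\<forall>k \<in> I. A k \<in> Obj C) \<longrightarrow> (\<exists>S j. is_coproduct C I A S j))"

record ('o, 'm) preadd_cat = "('o, 'm) cat" +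
  Add  :: "'m \<Rightarrow> 'm \<Rightarrow> 'm"  (infixl "\<oplus>\<index>" 65)
  Zero :: "'o \<Rightarrow> 'o \<Rightarrow> 'm"

definition Hom_group :: "('o, 'm, 'z) preadd_cat_scheme \<Rightarrow> 'o \<Rightarrow> 'o \<Rightarrow> 'm monoid" where
  "Hom_group C A B = \<lparr>carrier = Hom C A B, mult = Add C, one = Zero C A B\<rparr>"

abbreviation Neg :: "('o, 'm, 'z) preadd_cat_scheme \<Rightarrow> 'o \<Rightarrow> 'o \<Rightarrow> 'm \<Rightarrow> 'm" where
  "Neg C A B f \<equiv> inv\<^bsub>Hom_group C A B\<^esub> f"

locale preadditive_category = category C
  for C :: "('o, 'm, 'z) preadd_cat_scheme" (structure) +
  assumes Hom_comm_group: "\<lbrakk>A \<in> Obj C; B \<in> Obj C\<rbrakk> \<Longrightarrow> comm_group (Hom_group C A B)"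
    and Comp_Add_left: "\<lbrakk>f \<in> Hom C X Y; g \<in> Hom C Y Z; g' \<in> Hom C Y Z\<rbrakk>
          \<Longrightarrow> (g \<oplus> g') \<cdot> f = (g \<cdot> f) \<oplus> (g' \<cdot> f)"
    and Comp_Add_right: "\<lbrakk>f \<in> Hom C X Y; f' \<in> Hom C X Y; g \<in> Hom C Y Z\<rbrakk>
          \<Longrightarrow> g \<cdot> (f \<oplus> f') = (g \<cdot> f) \<oplus> (g \<cdot> f')"

text \<open>In a preadditive category finite coproducts, including the empty one, are
  automatically biproducts.\<close>

locale additive_category = preadditive_category C
  for C :: "('o, 'm, 'z) preadd_cat_scheme" (structure) +
  assumes finite_coproducts:
    "\<lbrakk>finite (I :: nat set); \<And>k. k \<in> I \<Longrightarrow> A k \<in> Obj C\<rbrakk> \<Longrightarrow> \<exists>S j. is_coproduct C I A S j"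


section \<open>Functors\<close>

record ('o, 'm, 'p, 'n) func =
  fobj :: "'o \<Rightarrow> 'p"
  farr :: "'m \<Rightarrow> 'n"

definition func_comp ::
  "('p, 'n, 'q, 'r) func \<Rightarrow> ('o, 'm, 'p, 'n) func \<Rightarrow> ('o, 'm, 'q, 'r) func" where
  "func_comp G F = \<lparr>fobj = fobj G \<circ> fobj F, farr = farr G \<circ> farr F\<rparr>"

definition covariant_functor ::
  "('o, 'm, 'y) cat_scheme \<Rightarrow> ('p, 'n, 'z) cat_scheme \<Rightarrow> ('o, 'm, 'p, 'n) func \<Rightarrow> bool" where
  "covariant_functor C D F \<longleftrightarrow>
     (\<forall>A \<in> Obj C. fobj F A \<in> Obj D) \<and>
     (\<forall>A B. \<forall>f \<in> Hom C A B. farr F f \<in> Hom D (fobj F A) (fobj F B)) \<and>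
     (\<forall>A \<in> Obj C. farr F (Ident C A) = Ident D (fobj F A)) \<and>
     (\<forall>X Y Z. \<forall>f \<in> Hom C X Y. \<forall>g \<in> Hom C Y Z.
        farr F (g \<cdot>\<^bsub>C\<^esub> f) = farr F g \<cdot>\<^bsub>D\<^esub> farr F f)"

definition additive_functor ::
  "('o, 'm, 'y) preadd_cat_scheme \<Rightarrow> ('p, 'n, 'z) preadd_cat_scheme
     \<Rightarrow> ('o, 'm, 'p, 'n) func \<Rightarrow> bool" where
  "additive_functor C D F \<longleftrightarrow>
     covariant_functor C D F \<and>
     (\<forall>A B. \<forall>f \<in> Hom C A B. \<forall>g \<in> Hom C A B.
        farr F (f \<oplus>\<^bsub>C\<^esub> g) = farr F f \<oplus>\<^bsub>D\<^esub> farr F g)"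

definition is_equivalence ::
  "('o, 'm, 'y) cat_scheme \<Rightarrow> ('p, 'n, 'z) cat_scheme \<Rightarrow> ('o, 'm, 'p, 'n) func \<Rightarrow> bool" where
  "is_equivalence C D F \<longleftrightarrow>
     covariant_functor C D F \<and>
     (\<forall>A \<in> Obj C. \<forall>B \<in> Obj C.
        bij_betw (farr F) (Hom C A B) (Hom D (fobj F A) (fobj F B))) \<and>
     (\<forall>B \<in> Obj D. \<exists>A \<in> Obj C. \<exists>f. iso_arrow D (fobj F A) B f)"

definition natural_iso ::
  "('o, 'm, 'y) cat_scheme \<Rightarrow> ('p, 'n, 'z) cat_scheme
     \<Rightarrow> ('o, 'm, 'p, 'n) func \<Rightarrow> ('o, 'm, 'p, 'n) func \<Rightarrow> ('o \<Rightarrow> 'n) \<Rightarrow> bool" where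
  "natural_iso C D F G \<theta> \<longleftrightarrow>
     (\<forall>A \<in> Obj C. iso_arrow D (fobj F A) (fobj G A) (\<theta> A)) \<and>
     (\<forall>A B. \<forall>f \<in> Hom C A B. \<theta> B \<cdot>\<^bsub>D\<^esub> farr F f = farr G f \<cdot>\<^bsub>D\<^esub> \<theta> A)"

definition preserves_countable_sums ::
  "('o, 'm, 'y) cat_scheme \<Rightarrow> ('p, 'n, 'z) cat_scheme \<Rightarrow> ('o, 'm, 'p, 'n) func \<Rightarrow> bool" where
  "preserves_countable_sums C D F \<longleftrightarrow>
     (\<forall>(I :: nat set) A S j. (\<forall>k \<in> I. A k \<in> Obj C) \<and> is_coproduct C I A S j \<longrightarrow>
        is_coproduct D I (\<lambda>k. fobj F (A k)) (fobj F S) (\<lambda>k. farr F (j k)))"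

text \<open>\<open>E : S \<rightarrow> T\<close> is left adjoint to \<open>F : T \<rightarrow> S\<close>, by bijections
  \<open>\<phi> A B : S(A, F B) \<rightarrow> T(E A, B)\<close> natural in \<open>A\<close> and \<open>B\<close>. For additive \<open>E\<close> and \<open>F\<close>
  such bijections are automatically additive.\<close>

definition adjunction ::
  "('o, 'm, 'y) cat_scheme \<Rightarrow> ('p, 'n, 'z) cat_scheme
     \<Rightarrow> ('o, 'm, 'p, 'n) func \<Rightarrow> ('p, 'n, 'o, 'm) func \<Rightarrow> ('o \<Rightarrow> 'p \<Rightarrow> 'm \<Rightarrow> 'n) \<Rightarrow> bool" where
  "adjunction S T E F \<phi> \<longleftrightarrow>
     (\<forall>A \<in> Obj S. \<forall>B \<in> Obj T.
        bij_betw (\<phi> A B) (Hom S A (fobj F B)) (Hom T (fobj E A) B)) \<and>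
     (\<forall>A \<in> Obj S. \<forall>A' \<in> Obj S. \<forall>B \<in> Obj T. \<forall>B' \<in> Obj T.
        \<forall>a \<in> Hom S A' A. \<forall>b \<in> Hom T B B'. \<forall>f \<in> Hom S A (fobj F B).
          \<phi> A' B' (farr F b \<cdot>\<^bsub>S\<^esub> f \<cdot>\<^bsub>S\<^esub> a) = b \<cdot>\<^bsub>T\<^esub> \<phi> A B f \<cdot>\<^bsub>T\<^esub> farr E a)"


section \<open>Triangulated categories\<close>

record ('o, 'm) tri_cat = "('o, 'm) preadd_cat" +
  Susp :: "('o, 'm, 'o, 'm) func"
  Tri  :: "('m \<times> 'm \<times> 'm) set"

abbreviation susp_obj :: "('o, 'm, 'z) tri_cat_scheme \<Rightarrow> 'o \<Rightarrow> 'o"  ("\<Sigma>\<^sub>o") where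
  "\<Sigma>\<^sub>o C \<equiv> fobj (Susp C)"

abbreviation susp_arr :: "('o, 'm, 'z) tri_cat_scheme \<Rightarrow> 'm \<Rightarrow> 'm"  ("\<Sigma>\<^sub>a") where
  "\<Sigma>\<^sub>a C \<equiv> farr (Susp C)"

definition exact_triangle ::
  "('o, 'm, 'z) tri_cat_scheme \<Rightarrow> 'o \<Rightarrow> 'o \<Rightarrow> 'o \<Rightarrow> 'm \<Rightarrow> 'm \<Rightarrow> 'm \<Rightarrow> bool" where
  "exact_triangle C X Y Z f g h \<longleftrightarrow>
     f \<in> Hom C X Y \<and> g \<in> Hom C Y Z \<and> h \<in> Hom C Z (\<Sigma>\<^sub>o C X) \<and> (f, g, h) \<in> Tri C"

text \<open>The suspension is only required to be an additive self-equivalence, which includes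
  the case of an automorphism. Axiom \<open>octahedral\<close> is the octahedral axiom for
  \<open>X \<rightarrow> Y \<rightarrow> Z\<close>, with cones \<open>U\<close> of \<open>f\<close>, \<open>W\<close> of \<open>g\<close>, and \<open>V\<close> of \<open>g \<cdot> f\<close>.\<close>

locale triangulated_category = additive_category C
  for C :: "('o, 'm, 'z) tri_cat_scheme" (structure) +
  assumes Susp_additive: "additive_functor C C (Susp C)"
    and Susp_equivalence: "is_equivalence C C (Susp C)"
    and triangle_iso:
      "\<lbrakk>exact_triangle C X Y Z f g h;
        f' \<in> Hom C X' Y'; g' \<in> Hom C Y' Z'; h' \<in> Hom C Z' (\<Sigma>\<^sub>o C X');
        iso_arrow C X X' u; iso_arrow C Y Y' v; iso_arrow C Z Z' w;
        v \<cdot> f = f' \<cdot> u; w \<cdot> g = g' \<cdot> v; \<Sigma>\<^sub>a C u \<cdot> h = h' \<cdot> w\<rbrakk>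
       \<Longrightarrow> exact_triangle C X' Y' Z' f' g' h'"
    and triangle_Id:
      "\<lbrakk>X \<in> Obj C; zero_object C Z\<rbrakk>
       \<Longrightarrow> exact_triangle C X X Z (Ident C X) (Zero C X Z) (Zero C Z (\<Sigma>\<^sub>o C X))"
    and triangle_exists:
      "f \<in> Hom C X Y \<Longrightarrow> \<exists>Z g h. exact_triangle C X Y Z f g h"
    and triangle_rotate:
      "\<lbrakk>f \<in> Hom C X Y; g \<in> Hom C Y Z; h \<in> Hom C Z (\<Sigma>\<^sub>o C X)\<rbrakk>
       \<Longrightarrow> exact_triangle C X Y Z f g h \<longleftrightarrow>
           exact_triangle C Y Z (\<Sigma>\<^sub>o C X) g h (Neg C (\<Sigma>\<^sub>o C X) (\<Sigma>\<^sub>o C Y) (\<Sigma>\<^sub>a C f))"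
    and triangle_morphism:
      "\<lbrakk>exact_triangle C X Y Z f g h; exact_triangle C X' Y' Z' f' g' h';
        u \<in> Hom C X X'; v \<in> Hom C Y Y'; v \<cdot> f = f' \<cdot> u\<rbrakk>
       \<Longrightarrow> \<exists>w \<in> Hom C Z Z'. w \<cdot> g = g' \<cdot> v \<and> \<Sigma>\<^sub>a C u \<cdot> h = h' \<cdot> w"
    and octahedral:
      "\<lbrakk>exact_triangle C X Y U f f\<^sub>1 f\<^sub>2; exact_triangle C Y Z W g g\<^sub>1 g\<^sub>2;
        exact_triangle C X Z V (g \<cdot> f) k\<^sub>1 k\<^sub>2\<rbrakk>
       \<Longrightarrow> \<exists>a b. exact_triangle C U V W a b (\<Sigma>\<^sub>a C f\<^sub>1 \<cdot> g\<^sub>2) \<and>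
             a \<cdot> f\<^sub>1 = k\<^sub>1 \<cdot> g \<and> k\<^sub>2 \<cdot> a = f\<^sub>2 \<and>
             b \<cdot> k\<^sub>1 = g\<^sub>1 \<and> g\<^sub>2 \<cdot> b = \<Sigma>\<^sub>a C f \<cdot> k\<^sub>2"

definition exact_functor ::
  "('o, 'm, 'y) tri_cat_scheme \<Rightarrow> ('p, 'n, 'z) tri_cat_scheme
     \<Rightarrow> ('o, 'm, 'p, 'n) func \<Rightarrow> bool" where
  "exact_functor C D F \<longleftrightarrow>
     additive_functor C D F \<and>
     (\<exists>\<theta>. natural_iso C D (func_comp F (Susp C)) (func_comp (Susp D) F) \<theta> \<and>
        (\<forall>X Y Z f g h. exact_triangle C X Y Z f g h \<longrightarrow>
           exact_triangle D (fobj F X) (fobj F Y) (fobj F Z)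
             (farr F f) (farr F g) (\<theta> X \<cdot>\<^bsub>D\<^esub> farr F h)))"

text \<open>Full subcategories are represented by their sets of objects.\<close>

definition triangulated_subcategory ::
  "('o, 'm, 'z) tri_cat_scheme \<Rightarrow> 'o set \<Rightarrow> bool" where
  "triangulated_subcategory C U \<longleftrightarrow>
     U \<subseteq> Obj C \<and>
     (\<forall>Z. zero_object C Z \<longrightarrow> Z \<in> U) \<and>
     (\<forall>A B f. A \<in> U \<and> iso_arrow C A B f \<longrightarrow> B \<in> U) \<and>
     (\<forall>A \<in> Obj C. \<Sigma>\<^sub>o C A \<in> U \<longleftrightarrow> A \<in> U) \<and>
     (\<forall>X Y Z f g h. exact_triangle C X Y Z f g h \<and> X \<in> U \<and> Y \<in> U \<longrightarrow> Z \<in> U)"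

definition thick_subcategory :: "('o, 'm, 'z) tri_cat_scheme \<Rightarrow> 'o set \<Rightarrow> bool" where
  "thick_subcategory C U \<longleftrightarrow>
     triangulated_subcategory C U \<and>
     (\<forall>A \<in> Obj C. \<forall>A' \<in> Obj C. \<forall>B \<in> U. \<forall>j.
        is_coproduct C (UNIV :: bool set) (\<lambda>b. if b then A else A') B j \<longrightarrow> A \<in> U)"

definition localizing_subcategory :: "('o, 'm, 'z) tri_cat_scheme \<Rightarrow> 'o set \<Rightarrow> bool" where
  "localizing_subcategory C U \<longleftrightarrow>
     triangulated_subcategory C U \<and>
     (\<forall>(I :: nat set) A B j. (\<forall>k \<in> I. A k \<in> U) \<and> is_coproduct C I A B j \<longrightarrow> B \<in> U)"

definition localizing_generated :: "('o, 'm, 'z) tri_cat_scheme \<Rightarrow> 'o set \<Rightarrow> 'o set" where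
  "localizing_generated C G = \<Inter> {U. localizing_subcategory C U \<and> G \<subseteq> U}"

definition complementary ::
  "('o, 'm, 'z) tri_cat_scheme \<Rightarrow> 'o set \<Rightarrow> 'o set \<Rightarrow> bool" where
  "complementary C L N \<longleftrightarrow>
     thick_subcategory C L \<and> thick_subcategory C N \<and>
     (\<forall>A \<in> L. \<forall>B \<in> N. Hom C A B = {Zero C A B}) \<and>
     (\<forall>A \<in> Obj C. \<exists>P \<in> L. \<exists>Q \<in> N. \<exists>f g h. exact_triangle C P A Q f g h)"


section \<open>Homological algebra relative to a system of morphisms\<close>

definition ker_functor ::
  "('o, 'm, 'y) preadd_cat_scheme \<Rightarrow> ('p, 'n, 'z) preadd_cat_scheme
     \<Rightarrow> ('o, 'm, 'p, 'n) func \<Rightarrow> 'o \<Rightarrow> 'o \<Rightarrow> 'm set" where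
  "ker_functor T S F A B =
     {f \<in> Hom T A B. farr F f = Zero S (fobj F A) (fobj F B)}"

definition I_projective ::
  "('o, 'm, 'z) preadd_cat_scheme \<Rightarrow> ('o \<Rightarrow> 'o \<Rightarrow> 'm set) \<Rightarrow> 'o \<Rightarrow> bool" where
  "I_projective T I P \<longleftrightarrow> P \<in> Obj T \<and> (\<forall>A \<in> Obj T. I P A = {Zero T P A})"

definition I_contractible ::
  "('o, 'm, 'z) cat_scheme \<Rightarrow> ('o \<Rightarrow> 'o \<Rightarrow> 'm set) \<Rightarrow> 'o set" where
  "I_contractible T I = {N \<in> Obj T. Ident T N \<in> I N N}"

text \<open>Chain complexes \<open>\<cdots> \<rightarrow> X 2 \<rightarrow> X 1 \<rightarrow> X 0 \<rightarrow> 0\<close> with \<open>d n : X (n + 1) \<rightarrow> X n\<close>.\<close>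

definition chain_complex ::
  "('o, 'm, 'z) preadd_cat_scheme \<Rightarrow> (nat \<Rightarrow> 'o) \<Rightarrow> (nat \<Rightarrow> 'm) \<Rightarrow> bool" where
  "chain_complex C X d \<longleftrightarrow>
     (\<forall>n. X n \<in> Obj C) \<and>
     (\<forall>n. d n \<in> Hom C (X (Suc n)) (X n)) \<and>
     (\<forall>n. d n \<cdot>\<^bsub>C\<^esub> d (Suc n) = Zero C (X (Suc (Suc n))) (X n))"

definition split_exact ::
  "('o, 'm, 'z) preadd_cat_scheme \<Rightarrow> (nat \<Rightarrow> 'o) \<Rightarrow> (nat \<Rightarrow> 'm) \<Rightarrow> bool" where
  "split_exact C X d \<longleftrightarrow>
     chain_complex C X d \<and>
     (\<exists>s. (\<forall>n. s n \<in> Hom C (X n) (X (Suc n))) \<and>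
        d 0 \<cdot>\<^bsub>C\<^esub> s 0 = Ident C (X 0) \<and>
        (\<forall>n. (d (Suc n) \<cdot>\<^bsub>C\<^esub> s (Suc n)) \<oplus>\<^bsub>C\<^esub> (s n \<cdot>\<^bsub>C\<^esub> d n) = Ident C (X (Suc n))))"

text \<open>The augmented complex has \<open>A\<close> in position \<open>0\<close> and \<open>P n\<close> in position \<open>n + 1\<close>, so
  that \<open>\<delta> 0 : P 0 \<rightarrow> A\<close> and \<open>\<delta> n : P n \<rightarrow> P (n - 1)\<close> for \<open>n > 0\<close>.\<close>

definition ker_projective_resolution ::
  "('o, 'm, 'y) preadd_cat_scheme \<Rightarrow> ('p, 'n, 'z) preadd_cat_scheme
     \<Rightarrow> ('o, 'm, 'p, 'n) func \<Rightarrow> 'o \<Rightarrow> (nat \<Rightarrow> 'o) \<Rightarrow> (nat \<Rightarrow> 'm) \<Rightarrow> bool" where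
  "ker_projective_resolution T S F A P \<delta> \<longleftrightarrow>
     chain_complex T (case_nat A P) \<delta> \<and>
     (\<forall>n. I_projective T (ker_functor T S F) (P n)) \<and>
     split_exact S (\<lambda>n. fobj F (case_nat A P n)) (\<lambda>n. farr F (\<delta> n))"

end

theory Submission
  imports Defs
begin

text \<open>Write \<open>\<epsilon> : E F \<rightarrow> 1\<close> for the counit. The resolution is the bar resolution of the comonad
  \<open>E F\<close>; its image under \<open>F\<close> is contracted by the unit.
  For complementarity let \<open>N 0 = A\<close> and let \<open>N (n + 1)\<close> be the cone of \<open>\<epsilon> : E F (N n) \<rightarrow> N n\<close>.
  Since \<open>F \<epsilon>\<close> is a split epimorphism, \<open>F\<close> kills \<open>N n \<rightarrow> N (n + 1)\<close>, hence kills the homotopy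
  colimit \<open>M\<close>, while the cone of \<open>A \<rightarrow> M\<close> is built from the objects \<open>E F (N n)\<close>.\<close>

section \<open>Arithmetic of morphisms\<close>

text \<open>Cones are not functorial, and this shapes the proof. A map between homotopy colimits
  obtained from the morphism axiom comes with no control over its cone, so none is formed that way.
  Instead the cone of a single composite, the diagonal of a commuting square, is compared with both
  of its factorisations, and each comparison is an exact triangle whose outer terms are known.
  Countable sums matter twice: the cone of a sum of maps is the sum of the cones, which keeps the
  comparison inside the localizing subcategory; and \<open>F\<close> preserves sums, so that it
  turns the map \<open>1 - shift\<close> defining the homotopy colimit into an identity, whose cone
  is zero. Thickness of the localizing subcategory comes from orthogonality and the approximating
  triangles, which identify it with a left orthogonal, rather than from a swindle with infinite
  sums. Since the suspension is only an equivalence, objects are desuspended up to isomorphism, and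
  the signs produced by rotation are absorbed explicitly.\<close>

text \<open>Reading source and target off \<open>g\<close> frees differences from the object
  annotations that \<open>Neg\<close> needs, as an inverse is taken in one particular Hom
  group.\<close>

definition Sub :: "('o, 'm, 'z) preadd_cat_scheme \<Rightarrow> 'm \<Rightarrow> 'm \<Rightarrow> 'm"  (infixl "\<ominus>\<index>" 65) where
  "f \<ominus>\<^bsub>C\<^esub> g = f \<oplus>\<^bsub>C\<^esub> Neg C (Dom C g) (Cod C g) g"

lemma Hom_group_simps [simp]:
  "carrier (Hom_group C A B) = Hom C A B"
  "x \<otimes>\<^bsub>Hom_group C A B\<^esub> y = x \<oplus>\<^bsub>C\<^esub> y"
  "\<one>\<^bsub>Hom_group C A B\<^esub> = Zero C A B"
  by (simp_all add: Hom_group_def)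

context category
begin

lemma Dom_Obj: "f \<in> Hom C A B \<Longrightarrow> A \<in> Obj C"
  using Dom_in_Obj by (auto simp: Hom_def)

lemma Cod_Obj: "f \<in> Hom C A B \<Longrightarrow> B \<in> Obj C"
  using Cod_in_Obj by (auto simp: Hom_def)

lemma iso_arrowE:
  assumes "iso_arrow C A B f"
  obtains g where "f \<in> Hom C A B" "g \<in> Hom C B A" "g \<cdot> f = Ident C A" "f \<cdot> g = Ident C B"
  using assms by (auto simp: iso_arrow_def)

lemma iso_arrow_Ident: "A \<in> Obj C \<Longrightarrow> iso_arrow C A A (Ident C A)"
  using Id_in_Hom Comp_Id_left by (fastforce simp: iso_arrow_def)

text \<open>Uniqueness in the universal property; it reduces later equations between maps out of a
  sum to the summands.\<close>

lemma coproduct_eqI: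
  assumes "is_coproduct C I A X j" "h \<in> Hom C X B" "h' \<in> Hom C X B"
    and "\<And>k. k \<in> I \<Longrightarrow> h \<cdot> j k = h' \<cdot> j k"
  shows "h = h'"
proof -
  have "\<forall>k\<in>I. h \<cdot> j k \<in> Hom C (A k) B"
    using assms Comp_in_Hom by (metis is_coproduct_def)
  moreover have "B \<in> Obj C" using assms(2) by (rule Cod_Obj)
  ultimately have "\<exists>!u. u \<in> Hom C X B \<and> (\<forall>k \<in> I. u \<cdot> j k = h \<cdot> j k)"
    using assms(1) unfolding is_coproduct_def by (elim conjE) (drule bspec, assumption, simp)
  then show ?thesis using assms(2-4) by (metis (no_types, lifting))
qed

lemma coproduct_desc:
  assumes "is_coproduct C I A X j" "B \<in> Obj C" "\<And>k. k \<in> I \<Longrightarrow> f k \<in> Hom C (A k) B"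
  obtains h where "h \<in> Hom C X B" "\<And>k. k \<in> I \<Longrightarrow> h \<cdot> j k = f k"
proof -
  have "\<exists>!h. h \<in> Hom C X B \<and> (\<forall>k \<in> I. h \<cdot> j k = f k)"
    using assms unfolding is_coproduct_def by (elim conjE) (drule bspec, assumption, simp)
  then show ?thesis using that by blast
qed

lemma coproduct_in_Hom: "is_coproduct C I A X j \<Longrightarrow> k \<in> I \<Longrightarrow> j k \<in> Hom C (A k) X"
  by (simp add: is_coproduct_def)

end

context preadditive_category
begin

lemma Zero_in_Hom: "A \<in> Obj C \<Longrightarrow> B \<in> Obj C \<Longrightarrow> Zero C A B \<in> Hom C A B"
  by (metis Hom_comm_group Hom_group_simps(1,3) comm_group.axioms(2) group.is_monoid monoid.one_closed)

lemma Hom_group: "f \<in> Hom C A B \<Longrightarrow> comm_group (Hom_group C A B)"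
  by (simp add: Cod_Obj Dom_Obj Hom_comm_group)

lemma Add_in_Hom:
  assumes "f \<in> Hom C A B" "g \<in> Hom C A B" shows "f \<oplus> g \<in> Hom C A B"
proof -
  interpret G: comm_group "Hom_group C A B" using Hom_group assms by blast
  show ?thesis using G.m_closed[of f g] assms by simp
qed

lemma Neg_in_Hom:
  assumes "f \<in> Hom C A B" shows "Neg C A B f \<in> Hom C A B"
proof -
  interpret G: comm_group "Hom_group C A B" using Hom_group assms by blast
  show ?thesis using G.inv_closed[of f] assms by simp
qed

lemma Sub_eq: "g \<in> Hom C A B \<Longrightarrow> f \<ominus> g = f \<oplus> Neg C A B g"
  by (simp add: Sub_def Hom_def)

lemma Sub_in_Hom: "f \<in> Hom C A B \<Longrightarrow> g \<in> Hom C A B \<Longrightarrow> f \<ominus> g \<in> Hom C A B"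
  by (simp add: Sub_eq Add_in_Hom Neg_in_Hom)

lemma Add_eq_cancel:
  assumes "f \<in> Hom C A B" "g \<in> Hom C A B" "g' \<in> Hom C A B" "f \<oplus> g = f \<oplus> g'"
  shows "g = g'"
proof -
  interpret G: comm_group "Hom_group C A B" using Hom_group assms by blast
  show ?thesis using G.Units_l_cancel[of f g g'] G.Units_eq assms by simp
qed

lemma
  assumes f: "f \<in> Hom C A B"
  shows Add_Zero_right: "f \<oplus> Zero C A B = f"
    and Add_Zero_left: "Zero C A B \<oplus> f = f"
    and Sub_self: "f \<ominus> f = Zero C A B"
    and Sub_Zero: "f \<ominus> Zero C A B = f"
    and Zero_Sub: "Zero C A B \<ominus> f = Neg C A B f"
    and Neg_Neg: "Neg C A B (Neg C A B f) = f"
proof -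
  interpret G: comm_group "Hom_group C A B" using Hom_group assms by blast
  have z: "Zero C A B \<in> Hom C A B" using f Zero_in_Hom Dom_Obj Cod_Obj by blast
  have n: "Neg C A B f \<in> Hom C A B" by (rule Neg_in_Hom[OF f])
  show "f \<oplus> Zero C A B = f" using G.r_one[of f] f by simp
  show "Zero C A B \<oplus> f = f" using G.l_one[of f] f by simp
  show "f \<ominus> f = Zero C A B" using G.r_inv[of f] f by (simp add: Sub_eq)
  show "f \<ominus> Zero C A B = f" using G.r_one[of f] G.inv_one f by (simp add: Sub_eq[OF z])
  show "Zero C A B \<ominus> f = Neg C A B f" using G.l_one[of "Neg C A B f"] f n by (simp add: Sub_eq)
  show "Neg C A B (Neg C A B f) = f" using G.inv_inv[of f] f by simp
qed

lemma
  assumes f: "f \<in> Hom C A B" and g: "g \<in> Hom C A B"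
  shows Add_commute: "f \<oplus> g = g \<oplus> f"
    and Sub_Add_cancel: "(f \<ominus> g) \<oplus> g = f"
    and Sub_Sub_cancel: "f \<ominus> (f \<ominus> g) = g"
    and Sub_eq_Zero_iff: "f \<ominus> g = Zero C A B \<longleftrightarrow> f = g"
    and Sub_Add_comm: "g \<oplus> (f \<ominus> g) = f"
proof -
  interpret G: comm_group "Hom_group C A B" using Hom_group assms by blast
  have n: "Neg C A B g \<in> Hom C A B" by (rule Neg_in_Hom[OF g])
  have s: "f \<ominus> g \<in> Hom C A B" using f g by (rule Sub_in_Hom)
  show comm: "f \<oplus> g = g \<oplus> f" using G.m_comm[of f g] f g by simp
  show 1: "(f \<ominus> g) \<oplus> g = f"
    using G.m_assoc[of f "Neg C A B g" g] G.l_inv[of g] f g n by (simp add: Sub_eq Add_Zero_right)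
  show 2: "g \<oplus> (f \<ominus> g) = f"
    using G.m_comm[of "f \<ominus> g" g] g s 1 by simp
  have n2: "f \<ominus> (f \<ominus> g) \<in> Hom C A B" using f s by (rule Sub_in_Hom)
  have "(f \<ominus> (f \<ominus> g)) \<oplus> (f \<ominus> g) = f"
    using G.m_assoc[of f "Neg C A B (f \<ominus> g)" "f \<ominus> g"] G.l_inv[of "f \<ominus> g"] f s Neg_in_Hom[OF s]
    by (simp add: Sub_eq[OF s] Add_Zero_right)
  then show "f \<ominus> (f \<ominus> g) = g"
    using G.right_cancel[of "f \<ominus> g" "f \<ominus> (f \<ominus> g)" g] 2 g s n2 by simp
  show "f \<ominus> g = Zero C A B \<longleftrightarrow> f = g"
    using 1 Add_Zero_left[OF g] Sub_self[OF g] by auto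
qed

lemma Comp_Zero_left:
  assumes f: "f \<in> Hom C X Y" and Z: "Z \<in> Obj C"
  shows "Zero C Y Z \<cdot> f = Zero C X Z"
proof -
  have z: "Zero C Y Z \<in> Hom C Y Z" using f Z Zero_in_Hom Cod_Obj by blast
  have c: "Zero C Y Z \<cdot> f \<in> Hom C X Z" using f z Comp_in_Hom by blast
  have "Zero C Y Z \<cdot> f \<oplus> Zero C Y Z \<cdot> f = Zero C Y Z \<cdot> f \<oplus> Zero C X Z"
    using Comp_Add_left[OF f z z] Add_Zero_right[OF z] Add_Zero_right[OF c] by simp
  then show ?thesis using Add_eq_cancel c Zero_in_Hom Dom_Obj[OF f] Z by blast
qed

lemma Comp_Zero_right:
  assumes g: "g \<in> Hom C Y Z" and X: "X \<in> Obj C"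
  shows "g \<cdot> Zero C X Y = Zero C X Z"
proof -
  have z: "Zero C X Y \<in> Hom C X Y" using g X Zero_in_Hom Dom_Obj by blast
  have c: "g \<cdot> Zero C X Y \<in> Hom C X Z" using g z Comp_in_Hom by blast
  have "g \<cdot> Zero C X Y \<oplus> g \<cdot> Zero C X Y = g \<cdot> Zero C X Y \<oplus> Zero C X Z"
    using Comp_Add_right[OF z z g] Add_Zero_right[OF z] Add_Zero_right[OF c] by simp
  then show ?thesis using Add_eq_cancel c Zero_in_Hom Cod_Obj[OF g] X by blast
qed

lemma Sub_eqI:
  assumes "f \<in> Hom C A B" "g \<in> Hom C A B" "h \<in> Hom C A B" "h \<oplus> g = f"
  shows "h = f \<ominus> g"
  by (metis assms Add_commute Add_eq_cancel Sub_Add_comm Sub_in_Hom)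

text \<open>The cancellation behind the telescoping sum in
  \<open>cone_telescope_constant\<close>.\<close>

lemma Sub_Sub_Sub:
  assumes a: "a \<in> Hom C A B" and b: "b \<in> Hom C A B" and c: "c \<in> Hom C A B"
  shows "(a \<ominus> b) \<ominus> (a \<ominus> c) = c \<ominus> b"
proof (rule Sub_eqI[symmetric])
  interpret G: comm_group "Hom_group C A B" using Hom_group a by blast
  note n = Neg_in_Hom[OF b] Neg_in_Hom[OF c]
  have "(c \<ominus> b) \<oplus> (a \<ominus> c) = (a \<oplus> Neg C A B b) \<oplus> (c \<oplus> Neg C A B c)"
    using G.m_ac[simplified] a b c n by (simp add: Sub_eq Add_in_Hom)
  then show "(c \<ominus> b) \<oplus> (a \<ominus> c) = a \<ominus> b"
    using G.r_inv[of c] G.r_one[of "a \<ominus> b"] Sub_in_Hom[OF a b] b c by (simp add: Sub_eq)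
qed (rule Sub_in_Hom[OF a b] Sub_in_Hom[OF a c] Sub_in_Hom[OF c b])+

lemma Comp_Sub_left:
  assumes f: "f \<in> Hom C X Y" and g: "g \<in> Hom C Y Z" "g' \<in> Hom C Y Z"
  shows "(g \<ominus> g') \<cdot> f = g \<cdot> f \<ominus> g' \<cdot> f"
proof (rule Sub_eqI)
  have s: "g \<ominus> g' \<in> Hom C Y Z" using g by (rule Sub_in_Hom)
  show "(g \<ominus> g') \<cdot> f \<oplus> g' \<cdot> f = g \<cdot> f"
    using Comp_Add_left[OF f s g(2)] Sub_Add_cancel[OF g] by simp
  show "g \<cdot> f \<in> Hom C X Z" "g' \<cdot> f \<in> Hom C X Z" "(g \<ominus> g') \<cdot> f \<in> Hom C X Z"
    using f g s Comp_in_Hom by blast+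
qed

lemma Comp_Sub_right:
  assumes f: "f \<in> Hom C X Y" "f' \<in> Hom C X Y" and g: "g \<in> Hom C Y Z"
  shows "g \<cdot> (f \<ominus> f') = g \<cdot> f \<ominus> g \<cdot> f'"
proof (rule Sub_eqI)
  have s: "f \<ominus> f' \<in> Hom C X Y" using f by (rule Sub_in_Hom)
  show "g \<cdot> (f \<ominus> f') \<oplus> g \<cdot> f' = g \<cdot> f"
    using Comp_Add_right[OF s f(2) g] Sub_Add_cancel[OF f] by simp
  show "g \<cdot> f \<in> Hom C X Z" "g \<cdot> f' \<in> Hom C X Z" "g \<cdot> (f \<ominus> f') \<in> Hom C X Z"
    using f g s Comp_in_Hom by blast+
qed

lemma Comp_Neg_left:
  assumes f: "f \<in> Hom C X Y" and g: "g \<in> Hom C Y Z"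
  shows "Neg C Y Z g \<cdot> f = Neg C X Z (g \<cdot> f)"
  using Comp_Sub_left[OF f Zero_in_Hom g] Zero_Sub[OF g] Comp_Zero_left[OF f]
    Zero_Sub[OF Comp_in_Hom[OF f g]] Dom_Obj[OF g] Cod_Obj[OF g] by simp

lemma Comp_Neg_right:
  assumes f: "f \<in> Hom C X Y" and g: "g \<in> Hom C Y Z"
  shows "g \<cdot> Neg C X Y f = Neg C X Z (g \<cdot> f)"
  using Comp_Sub_right[OF Zero_in_Hom f g] Zero_Sub[OF f] Comp_Zero_right[OF g]
    Zero_Sub[OF Comp_in_Hom[OF f g]] Dom_Obj[OF f] Cod_Obj[OF f] by simp

lemma Neg_eq_Zero_iff:
  assumes f: "f \<in> Hom C X Y"
  shows "Neg C X Y f = Zero C X Y \<longleftrightarrow> f = Zero C X Y"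
  using Sub_eq_Zero_iff[OF Zero_in_Hom f] Zero_Sub[OF f] Dom_Obj[OF f] Cod_Obj[OF f] by auto

text \<open>Replaces a universal property by an equation of morphisms, which additive functors
  preserve and retracts inherit.\<close>

lemma zero_object_iff: "zero_object C Z \<longleftrightarrow> Z \<in> Obj C \<and> Ident C Z = Zero C Z Z"
proof
  assume "zero_object C Z"
  then show "Z \<in> Obj C \<and> Ident C Z = Zero C Z Z"
    by (metis Id_in_Hom Zero_in_Hom zero_object_def)
next
  assume Z: "Z \<in> Obj C \<and> Ident C Z = Zero C Z Z"
  have "f = Zero C Z A" if "f \<in> Hom C Z A" for f A
    using that Z Comp_Id_right[OF that] Comp_Zero_right[OF that] by simp
  moreover have "f = Zero C A Z" if "f \<in> Hom C A Z" for f A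
    using that Z Comp_Id_left[OF that] Comp_Zero_left[OF that] by simp
  ultimately show "zero_object C Z"
    using Z Zero_in_Hom unfolding zero_object_def by metis
qed

lemma Hom_from_zero:
  assumes "Ident C Z = Zero C Z Z" "f \<in> Hom C Z A" shows "f = Zero C Z A"
  using assms(1) Comp_Id_right[OF assms(2)] Comp_Zero_right[OF assms(2) Dom_Obj[OF assms(2)]] by simp

lemma Hom_to_zero:
  assumes "Ident C Z = Zero C Z Z" "f \<in> Hom C A Z" shows "f = Zero C A Z"
  using assms(1) Comp_Id_left[OF assms(2)] Comp_Zero_left[OF assms(2) Cod_Obj[OF assms(2)]] by simp

lemma retract_of_zero:
  assumes "Ident C B = Zero C B B" "j \<in> Hom C A B" "p \<in> Hom C B A" "p \<cdot> j = Ident C A"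
  shows "Ident C A = Zero C A A"
  using Hom_to_zero[OF assms(1,2)] Comp_Zero_right[OF assms(3) Dom_Obj[OF assms(2)]] assms(4) by simp

text \<open>The projection is induced by the identity on one summand and zero on the other. Closure
  under direct summands thereby reduces to closure under retracts.\<close>

lemma coproduct_bool_retract:
  assumes "is_coproduct C (UNIV :: bool set) (\<lambda>b. if b then A else A') B j" "A \<in> Obj C" "A' \<in> Obj C"
  obtains p where "j True \<in> Hom C A B" "p \<in> Hom C B A" "p \<cdot> j True = Ident C A"
proof -
  obtain p where "p \<in> Hom C B A" "\<And>k. p \<cdot> j k = (if k then Ident C A else Zero C A' A)"
    by (rule coproduct_desc[OF assms(1), of A "\<lambda>k. if k then Ident C A else Zero C A' A"])
      (auto simp: assms Id_in_Hom Zero_in_Hom)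
  then show ?thesis
    using that coproduct_in_Hom[OF assms(1), of True] by auto
qed

end

section \<open>Additive functors on zero morphisms and differences\<close>

lemma additive_functor_Hom:
  "additive_functor C D G \<Longrightarrow> f \<in> Hom C A B \<Longrightarrow> farr G f \<in> Hom D (fobj G A) (fobj G B)"
  by (simp add: additive_functor_def covariant_functor_def)

lemma additive_functor_Obj: "additive_functor C D G \<Longrightarrow> A \<in> Obj C \<Longrightarrow> fobj G A \<in> Obj D"
  by (simp add: additive_functor_def covariant_functor_def)

lemma additive_functor_Ident:
  "additive_functor C D G \<Longrightarrow> A \<in> Obj C \<Longrightarrow> farr G (Ident C A) = Ident D (fobj G A)"
  by (simp add: additive_functor_def covariant_functor_def)

lemma additive_functor_Comp:
  "additive_functor C D G \<Longrightarrow> f \<in> Hom C X Y \<Longrightarrow> g \<in> Hom C Y Z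
    \<Longrightarrow> farr G (g \<cdot>\<^bsub>C\<^esub> f) = farr G g \<cdot>\<^bsub>D\<^esub> farr G f"
  unfolding additive_functor_def covariant_functor_def by blast

lemma additive_functor_Add:
  "additive_functor C D G \<Longrightarrow> f \<in> Hom C X Y \<Longrightarrow> g \<in> Hom C X Y
    \<Longrightarrow> farr G (g \<oplus>\<^bsub>C\<^esub> f) = farr G g \<oplus>\<^bsub>D\<^esub> farr G f"
  unfolding additive_functor_def by blast

lemmas additive_functor_simps =
  additive_functor_Hom additive_functor_Obj additive_functor_Ident additive_functor_Comp

lemma additive_functor_Zero:
  assumes C: "preadditive_category C" and D: "preadditive_category D"
    and G: "additive_functor C D G" and A: "A \<in> Obj C" and B: "B \<in> Obj C"
  shows "farr G (Zero C A B) = Zero D (fobj G A) (fobj G B)"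
proof -
  interpret C: preadditive_category C by fact
  interpret D: preadditive_category D by fact
  have z: "Zero C A B \<in> Hom C A B" using A B by (rule C.Zero_in_Hom)
  have h: "farr G (Zero C A B) \<in> Hom D (fobj G A) (fobj G B)"
    by (rule additive_functor_Hom[OF G z])
  have "farr G (Zero C A B) \<oplus>\<^bsub>D\<^esub> farr G (Zero C A B) = farr G (Zero C A B) \<oplus>\<^bsub>D\<^esub> Zero D (fobj G A) (fobj G B)"
    using additive_functor_Add[OF G z z] C.Add_Zero_right[OF z] D.Add_Zero_right[OF h] by simp
  then show ?thesis
    using D.Add_eq_cancel h D.Zero_in_Hom D.Dom_Obj[OF h] D.Cod_Obj[OF h] by blast
qed

lemma additive_functor_Sub:
  assumes C: "preadditive_category C" and D: "preadditive_category D"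
    and G: "additive_functor C D G" and f: "f \<in> Hom C A B" and g: "g \<in> Hom C A B"
  shows "farr G (f \<ominus>\<^bsub>C\<^esub> g) = farr G f \<ominus>\<^bsub>D\<^esub> farr G g"
proof -
  interpret C: preadditive_category C by fact
  interpret D: preadditive_category D by fact
  have s: "f \<ominus>\<^bsub>C\<^esub> g \<in> Hom C A B" using f g by (rule C.Sub_in_Hom)
  show ?thesis
    using D.Sub_eqI additive_functor_Hom[OF G f] additive_functor_Hom[OF G g]
      additive_functor_Hom[OF G s] additive_functor_Add[OF G g s] C.Sub_Add_cancel[OF f g] by simp
qed

section \<open>Exactness in triangulated categories\<close>

context triangulated_category
begin

lemma Susp_Obj: "A \<in> Obj C \<Longrightarrow> \<Sigma>\<^sub>o C A \<in> Obj C"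
  using Susp_additive by (rule additive_functor_Obj)

lemma Susp_Hom: "f \<in> Hom C A B \<Longrightarrow> \<Sigma>\<^sub>a C f \<in> Hom C (\<Sigma>\<^sub>o C A) (\<Sigma>\<^sub>o C B)"
  using Susp_additive by (rule additive_functor_Hom)

lemma Susp_Ident: "A \<in> Obj C \<Longrightarrow> \<Sigma>\<^sub>a C (Ident C A) = Ident C (\<Sigma>\<^sub>o C A)"
  using Susp_additive by (rule additive_functor_Ident)

lemma Susp_Comp:
  "f \<in> Hom C X Y \<Longrightarrow> g \<in> Hom C Y Z \<Longrightarrow> \<Sigma>\<^sub>a C (g \<cdot> f) = \<Sigma>\<^sub>a C g \<cdot> \<Sigma>\<^sub>a C f"
  using Susp_additive by (rule additive_functor_Comp)

lemma Susp_Zero: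
  "A \<in> Obj C \<Longrightarrow> B \<in> Obj C \<Longrightarrow> \<Sigma>\<^sub>a C (Zero C A B) = Zero C (\<Sigma>\<^sub>o C A) (\<Sigma>\<^sub>o C B)"
  by (rule additive_functor_Zero[OF preadditive_category_axioms preadditive_category_axioms Susp_additive])

lemma Susp_Neg:
  assumes f: "f \<in> Hom C A B"
  shows "\<Sigma>\<^sub>a C (Neg C A B f) = Neg C (\<Sigma>\<^sub>o C A) (\<Sigma>\<^sub>o C B) (\<Sigma>\<^sub>a C f)"
  using additive_functor_Sub[OF preadditive_category_axioms preadditive_category_axioms Susp_additive
      Zero_in_Hom f] Zero_Sub[OF f] Zero_Sub[OF Susp_Hom[OF f]] Dom_Obj[OF f] Cod_Obj[OF f]
  by (simp add: Susp_Zero)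

lemma Susp_full:
  assumes "A \<in> Obj C" "B \<in> Obj C" "g \<in> Hom C (\<Sigma>\<^sub>o C A) (\<Sigma>\<^sub>o C B)"
  obtains f where "f \<in> Hom C A B" "\<Sigma>\<^sub>a C f = g"
proof -
  have "g \<in> \<Sigma>\<^sub>a C ` Hom C A B"
    using Susp_equivalence assms by (simp add: is_equivalence_def bij_betw_def)
  then show ?thesis using that by blast
qed

lemma Susp_faithful:
  assumes "f \<in> Hom C A B" "g \<in> Hom C A B" "\<Sigma>\<^sub>a C f = \<Sigma>\<^sub>a C g"
  shows "f = g"
  using Susp_equivalence assms Dom_Obj[OF assms(1)] Cod_Obj[OF assms(1)]
  unfolding is_equivalence_def bij_betw_def inj_on_def by blast

text \<open>Desuspension is available only up to the isomorphism \<open>u\<close>, which later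
  arguments have to carry along.\<close>

lemma Susp_surj:
  assumes "B \<in> Obj C"
  obtains A u where "A \<in> Obj C" "iso_arrow C (\<Sigma>\<^sub>o C A) B u"
  using Susp_equivalence assms unfolding is_equivalence_def by blast

lemma Susp_zero_iff:
  assumes "A \<in> Obj C"
  shows "Ident C (\<Sigma>\<^sub>o C A) = Zero C (\<Sigma>\<^sub>o C A) (\<Sigma>\<^sub>o C A) \<longleftrightarrow> Ident C A = Zero C A A"
  by (metis Id_in_Hom Susp_Ident Susp_Zero Susp_faithful Zero_in_Hom assms)

text \<open>An empty coproduct admits only one endomorphism, so its identity is zero.\<close>

lemma zero_object_exists: obtains Z where "zero_object C Z"
proof -
  obtain Z j where Z: "is_coproduct C ({} :: nat set) undefined Z j"
    using finite_coproducts[of "{}" undefined] by auto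
  have "Z \<in> Obj C" using Z by (simp add: is_coproduct_def)
  then have "zero_object C Z"
    using coproduct_eqI[OF Z, of "Ident C Z" Z "Zero C Z Z"] Id_in_Hom Zero_in_Hom
    by (simp add: zero_object_iff)
  then show ?thesis by (rule that)
qed

section \<open>Vanishing and factorisation in exact triangles\<close>

lemma triangle_Hom:
  assumes "exact_triangle C X Y Z f g h"
  shows "f \<in> Hom C X Y" "g \<in> Hom C Y Z" "h \<in> Hom C Z (\<Sigma>\<^sub>o C X)"
  using assms by (auto simp: exact_triangle_def)

lemma triangle_Obj:
  assumes "exact_triangle C X Y Z f g h"
  shows "X \<in> Obj C" "Y \<in> Obj C" "Z \<in> Obj C"
  using triangle_Hom[OF assms] Dom_Obj by auto

lemma rotate:
  assumes "exact_triangle C X Y Z f g h"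
  shows "exact_triangle C Y Z (\<Sigma>\<^sub>o C X) g h (Neg C (\<Sigma>\<^sub>o C X) (\<Sigma>\<^sub>o C Y) (\<Sigma>\<^sub>a C f))"
  using triangle_rotate[OF triangle_Hom[OF assms]] assms by simp

text \<open>The pair of the identity and \<open>f\<close> maps the triangle on
  \<open>Ident C X\<close> to the given one; commutativity on the third terms factors
  \<open>g \<cdot> f\<close> through a zero object.\<close>

lemma triangle_comp_zero:
  assumes t: "exact_triangle C X Y Z f g h"
  shows "g \<cdot> f = Zero C X Z"
proof -
  note H = triangle_Hom[OF t] triangle_Obj[OF t]
  obtain O' where O': "zero_object C O'" by (rule zero_object_exists)
  have O'': "O' \<in> Obj C" "Ident C O' = Zero C O' O'" using O' by (simp_all add: zero_object_iff)
  obtain w where w: "w \<in> Hom C O' Z" "w \<cdot> Zero C X O' = g \<cdot> f"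
    using triangle_morphism[OF triangle_Id[OF H(4) O'] t Id_in_Hom[OF H(4)] H(1)] by auto
  then show ?thesis using Comp_Zero_right[OF w(1) H(4)] by simp
qed

lemma triangle_comp_zero':
  assumes t: "exact_triangle C X Y Z f g h"
  shows "\<Sigma>\<^sub>a C f \<cdot> h = Zero C Z (\<Sigma>\<^sub>o C Y)"
proof -
  note H = triangle_Hom[OF t] triangle_Obj[OF t]
  have "Neg C Z (\<Sigma>\<^sub>o C Y) (\<Sigma>\<^sub>a C f \<cdot> h) = Zero C Z (\<Sigma>\<^sub>o C Y)"
    using triangle_comp_zero[OF rotate[OF rotate[OF t]]] Comp_Neg_left[OF H(3) Susp_Hom[OF H(1)]]
    by simp
  then show ?thesis using Neg_eq_Zero_iff[OF Comp_in_Hom[OF H(3) Susp_Hom[OF H(1)]]] by simp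
qed

text \<open>Rotating the identity triangle of \<open>W\<close> backwards works because its third
  term may be taken to be the suspension of \<open>Z\<close>, which is again zero.\<close>

lemma triangle_zero_Id:
  assumes W: "W \<in> Obj C" and Z: "zero_object C Z"
  shows "exact_triangle C Z W W (Zero C Z W) (Ident C W) (Zero C W (\<Sigma>\<^sub>o C Z))"
proof -
  have Z': "Z \<in> Obj C" "Ident C Z = Zero C Z Z" using Z by (simp_all add: zero_object_iff)
  have "zero_object C (\<Sigma>\<^sub>o C Z)"
    using Z' Susp_zero_iff Susp_Obj by (simp add: zero_object_iff)
  from triangle_Id[OF W this]
  have "exact_triangle C W W (\<Sigma>\<^sub>o C Z) (Ident C W) (Zero C W (\<Sigma>\<^sub>o C Z))
         (Zero C (\<Sigma>\<^sub>o C Z) (\<Sigma>\<^sub>o C W))" .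
  moreover have "Neg C (\<Sigma>\<^sub>o C Z) (\<Sigma>\<^sub>o C W) (\<Sigma>\<^sub>a C (Zero C Z W)) = Zero C (\<Sigma>\<^sub>o C Z) (\<Sigma>\<^sub>o C W)"
    using Z' W Neg_eq_Zero_iff[OF Zero_in_Hom] by (simp add: Susp_Zero Susp_Obj)
  ultimately show ?thesis
    using triangle_rotate[OF Zero_in_Hom Id_in_Hom Zero_in_Hom] W Z' Susp_Obj by simp
qed

text \<open>This makes \<open>g\<close> a weak cokernel of \<open>f\<close>: \<open>a\<close> and a
  zero map form a morphism to the triangle \<open>0 \<rightarrow> W = W\<close>, and its third
  component is the factorisation. Uniqueness fails in general.\<close>

lemma triangle_factor:
  assumes t: "exact_triangle C X Y Z f g h" and a: "a \<in> Hom C Y W" "a \<cdot> f = Zero C X W"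
  obtains b where "b \<in> Hom C Z W" "b \<cdot> g = a"
proof -
  note H = triangle_Hom[OF t] triangle_Obj[OF t]
  obtain O' where O': "zero_object C O'" by (rule zero_object_exists)
  have O'': "O' \<in> Obj C" using O' by (simp add: zero_object_iff)
  have W: "W \<in> Obj C" using a(1) by (rule Cod_Obj)
  have "a \<cdot> f = Zero C O' W \<cdot> Zero C X O'"
    using a(2) Comp_Zero_left[OF Zero_in_Hom[OF H(4) O''] W] by simp
  from triangle_morphism[OF t triangle_zero_Id[OF W O'] Zero_in_Hom[OF H(4) O''] a(1) this]
  obtain w where "w \<in> Hom C Z W" "w \<cdot> g = a" using Comp_Id_left[OF a(1)] by auto
  then show ?thesis by (rule that)
qed

lemma triangle_factor':
  assumes t: "exact_triangle C X Y Z f g h" and a: "a \<in> Hom C Z W" "a \<cdot> g = Zero C Y W"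
  obtains b where "b \<in> Hom C (\<Sigma>\<^sub>o C X) W" "b \<cdot> h = a"
  using triangle_factor[OF rotate[OF t] a] by blast

text \<open>Two rotations put a sign on the suspension of \<open>f\<close>; replacing the factor by
  its negative moves the sign away.\<close>

lemma triangle_factor'':
  assumes t: "exact_triangle C X Y Z f g h"
    and a: "a \<in> Hom C (\<Sigma>\<^sub>o C X) W" "a \<cdot> h = Zero C Z W"
  obtains b where "b \<in> Hom C (\<Sigma>\<^sub>o C Y) W" "b \<cdot> \<Sigma>\<^sub>a C f = a"
proof -
  note H = triangle_Hom[OF t] triangle_Obj[OF t]
  obtain b where b: "b \<in> Hom C (\<Sigma>\<^sub>o C Y) W"
      "b \<cdot> Neg C (\<Sigma>\<^sub>o C X) (\<Sigma>\<^sub>o C Y) (\<Sigma>\<^sub>a C f) = a"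
    using triangle_factor[OF rotate[OF rotate[OF t]] a] by blast
  have "Neg C (\<Sigma>\<^sub>o C Y) W b \<cdot> \<Sigma>\<^sub>a C f = a"
    using b Comp_Neg_left[OF Susp_Hom[OF H(1)] b(1)] Comp_Neg_right[OF Susp_Hom[OF H(1)] b(1)] by simp
  then show ?thesis using that Neg_in_Hom[OF b(1)] by blast
qed

text \<open>As \<open>g\<close> vanishes, the identity of \<open>Z\<close> factors through
  \<open>h\<close>, which vanishes too.\<close>

lemma cone_zero:
  assumes t: "exact_triangle C X Y Z f g h"
    and g: "g = Zero C Y Z" and h: "h = Zero C Z (\<Sigma>\<^sub>o C X)"
  shows "Ident C Z = Zero C Z Z"
proof -
  note H = triangle_Hom[OF t] triangle_Obj[OF t]
  have "Ident C Z \<cdot> g = Zero C Y Z" using g Comp_Id_left[OF H(2)] by simp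
  then obtain b where b: "b \<in> Hom C (\<Sigma>\<^sub>o C X) Z" "b \<cdot> h = Ident C Z"
    by (rule triangle_factor'[OF t Id_in_Hom[OF H(6)]])
  then show ?thesis using h Comp_Zero_right[OF b(1) H(6)] by simp
qed

lemma cone_Ident_zero:
  assumes t: "exact_triangle C X X Z (Ident C X) g h"
  shows "Ident C Z = Zero C Z Z"
proof (rule cone_zero[OF t])
  note H = triangle_Hom[OF t] triangle_Obj[OF t]
  show "g = Zero C X Z" using triangle_comp_zero[OF t] Comp_Id_right[OF H(2)] by simp
  show "h = Zero C Z (\<Sigma>\<^sub>o C X)"
    using triangle_comp_zero'[OF t] Comp_Id_left[OF H(3)] Susp_Ident[OF H(4)] by simp
qed

text \<open>The hypotheses present \<open>Y\<close> as the sum of \<open>X\<close> and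
  \<open>A\<close>. The retraction forces \<open>h = 0\<close>, so an endomorphism of
  \<open>Z\<close> that kills \<open>g\<close> is zero. Applied to the defect of
  \<open>g \<cdot> i\<close> as an inverse of the induced map \<open>w\<close>, this gives the
  isomorphism.\<close>

lemma cone_split_mono:
  assumes t: "exact_triangle C X Y Z f g h"
    and r: "r \<in> Hom C Y X" "r \<cdot> f = Ident C X"
    and p: "p \<in> Hom C Y A" and i: "i \<in> Hom C A Y" and pi: "p \<cdot> i = Ident C A"
    and pf: "p \<cdot> f = Zero C X A" and ip: "i \<cdot> p = Ident C Y \<ominus> f \<cdot> r"
  shows "\<exists>w. iso_arrow C Z A w"
proof -
  note H = triangle_Hom[OF t] triangle_Obj[OF t]
  obtain w where w: "w \<in> Hom C Z A" "w \<cdot> g = p" by (rule triangle_factor[OF t p pf])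
  have "\<Sigma>\<^sub>a C r \<cdot> (\<Sigma>\<^sub>a C f \<cdot> h) = h"
    using Comp_assoc[OF H(3) Susp_Hom[OF H(1)] Susp_Hom[OF r(1)]] Susp_Comp[OF H(1) r(1)] r(2)
      Susp_Ident[OF H(4)] Comp_Id_left[OF H(3)] by simp
  then have h: "h = Zero C Z (\<Sigma>\<^sub>o C X)"
    using triangle_comp_zero'[OF t] Comp_Zero_right[OF Susp_Hom[OF r(1)] H(6)] by simp
  have gi: "g \<cdot> i \<in> Hom C A Z" using i H(2) by (rule Comp_in_Hom)
  have giw: "(g \<cdot> i) \<cdot> w \<in> Hom C Z Z" using w(1) gi by (rule Comp_in_Hom)
  have fr: "f \<cdot> r \<in> Hom C Y Y" using r(1) H(1) by (rule Comp_in_Hom)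
  have "((g \<cdot> i) \<cdot> w) \<cdot> g = g \<cdot> (i \<cdot> p)"
    using Comp_assoc[OF H(2) w(1) gi] Comp_assoc[OF p i H(2)] w(2) by simp
  also have "\<dots> = g \<cdot> Ident C Y \<ominus> g \<cdot> (f \<cdot> r)"
    using ip Comp_Sub_right[OF Id_in_Hom[OF H(5)] fr H(2)] by simp
  also have "g \<cdot> (f \<cdot> r) = Zero C Y Z"
    using Comp_assoc[OF r(1) H(1,2)] triangle_comp_zero[OF t] Comp_Zero_left[OF r(1) H(6)] by simp
  also have "g \<cdot> Ident C Y \<ominus> Zero C Y Z = g" using Comp_Id_right[OF H(2)] Sub_Zero[OF H(2)] by simp
  finally have "((g \<cdot> i) \<cdot> w \<ominus> Ident C Z) \<cdot> g = Zero C Y Z"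
    using Comp_Sub_left[OF H(2) giw Id_in_Hom[OF H(6)]] Comp_Id_left[OF H(2)] Sub_self[OF H(2)] by simp
  then obtain b where b: "b \<in> Hom C (\<Sigma>\<^sub>o C X) Z" "b \<cdot> h = (g \<cdot> i) \<cdot> w \<ominus> Ident C Z"
    by (rule triangle_factor'[OF t Sub_in_Hom[OF giw Id_in_Hom[OF H(6)]]])
  then have "(g \<cdot> i) \<cdot> w = Ident C Z"
    using h Comp_Zero_right[OF b(1) H(6)] Sub_eq_Zero_iff[OF giw Id_in_Hom[OF H(6)]] by simp
  moreover have "w \<cdot> (g \<cdot> i) = Ident C A"
    using Comp_assoc[OF i H(2) w(1)] w(2) pi by simp
  ultimately show ?thesis using w(1) gi by (auto simp: iso_arrow_def)
qed

section \<open>Suspensions and cones of coproducts\<close>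

text \<open>A test object \<open>B\<close> need not be a suspension, so it is first replaced by an
  isomorphic one; full faithfulness then transports the universal property of
  \<open>X\<close>.\<close>

lemma Susp_coproduct:
  assumes X: "is_coproduct C I A X j" and A: "\<And>k. k \<in> I \<Longrightarrow> A k \<in> Obj C"
  shows "is_coproduct C I (\<lambda>k. \<Sigma>\<^sub>o C (A k)) (\<Sigma>\<^sub>o C X) (\<lambda>k. \<Sigma>\<^sub>a C (j k))"
proof -
  have XO: "X \<in> Obj C" using X by (simp add: is_coproduct_def)
  note j = coproduct_in_Hom[OF X]
  have "\<exists>!h. h \<in> Hom C (\<Sigma>\<^sub>o C X) B \<and> (\<forall>k\<in>I. h \<cdot> \<Sigma>\<^sub>a C (j k) = f k)"
    if B: "B \<in> Obj C" and f: "\<forall>k\<in>I. f k \<in> Hom C (\<Sigma>\<^sub>o C (A k)) B" for B f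
  proof -
    obtain B' u where B': "B' \<in> Obj C" "iso_arrow C (\<Sigma>\<^sub>o C B') B u" using Susp_surj[OF B] .
    obtain v where u: "u \<in> Hom C (\<Sigma>\<^sub>o C B') B" and v: "v \<in> Hom C B (\<Sigma>\<^sub>o C B')"
      and vu: "v \<cdot> u = Ident C (\<Sigma>\<^sub>o C B')" and uv: "u \<cdot> v = Ident C B"
      using B'(2) by (rule iso_arrowE)
    have "\<exists>f'. f' \<in> Hom C (A k) B' \<and> \<Sigma>\<^sub>a C f' = v \<cdot> f k" if "k \<in> I" for k
      using Susp_full[OF A[OF that] B'(1) Comp_in_Hom[OF f[rule_format, OF that] v]] by blast
    then obtain f' where f': "\<And>k. k \<in> I \<Longrightarrow> f' k \<in> Hom C (A k) B'"
      "\<And>k. k \<in> I \<Longrightarrow> \<Sigma>\<^sub>a C (f' k) = v \<cdot> f k" by metis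
    obtain h where h: "h \<in> Hom C X B'" "\<And>k. k \<in> I \<Longrightarrow> h \<cdot> j k = f' k"
      using coproduct_desc[OF X B'(1) f'(1)] by blast
    show ?thesis
    proof (intro ex1I[of _ "u \<cdot> \<Sigma>\<^sub>a C h"] conjI ballI)
      show "u \<cdot> \<Sigma>\<^sub>a C h \<in> Hom C (\<Sigma>\<^sub>o C X) B" using Susp_Hom[OF h(1)] u by (rule Comp_in_Hom)
      show "(u \<cdot> \<Sigma>\<^sub>a C h) \<cdot> \<Sigma>\<^sub>a C (j k) = f k" if k: "k \<in> I" for k
        using Comp_assoc[OF Susp_Hom[OF j[OF k]] Susp_Hom[OF h(1)] u] Susp_Comp[OF j[OF k] h(1)]
          h(2)[OF k] f'(2)[OF k] Comp_assoc[OF f[rule_format, OF k] v u, symmetric] uv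
          Comp_Id_left[OF f[rule_format, OF k]] by simp
      fix h' assume h': "h' \<in> Hom C (\<Sigma>\<^sub>o C X) B \<and> (\<forall>k\<in>I. h' \<cdot> \<Sigma>\<^sub>a C (j k) = f k)"
      then have h'H: "h' \<in> Hom C (\<Sigma>\<^sub>o C X) B" by simp
      obtain h'' where h'': "h'' \<in> Hom C X B'" "\<Sigma>\<^sub>a C h'' = v \<cdot> h'"
        by (rule Susp_full[OF XO B'(1) Comp_in_Hom[OF h'H v]])
      have "h'' = h"
      proof (rule coproduct_eqI[OF X h''(1) h(1)])
        fix k assume k: "k \<in> I"
        have "\<Sigma>\<^sub>a C (h'' \<cdot> j k) = \<Sigma>\<^sub>a C (f' k)"
          using Susp_Comp[OF j[OF k] h''(1)] h''(2) Comp_assoc[OF Susp_Hom[OF j[OF k]] h'H v]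
            h' k f'(2)[OF k] by simp
        then have "h'' \<cdot> j k = f' k"
          by (rule Susp_faithful[OF Comp_in_Hom[OF j[OF k] h''(1)] f'(1)[OF k]])
        then show "h'' \<cdot> j k = h \<cdot> j k" using h(2)[OF k] by simp
      qed
      then show "h' = u \<cdot> \<Sigma>\<^sub>a C h"
        using h''(2) Comp_assoc[OF h'H v u, symmetric] uv Comp_Id_left[OF h'H] by simp
    qed
  qed
  then show ?thesis
    using Susp_Obj[OF XO] Susp_Hom[OF j] by (auto simp: is_coproduct_def)
qed

text \<open>The argument is the five lemma for \<open>Hom(-, W)\<close>, applied directly to the comparison maps.\<close>

lemma cone_coproduct:
  assumes t: "\<And>k. k \<in> I \<Longrightarrow> exact_triangle C (A k) (B k) (D k) (f k) (g k) (h k)"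
    and X: "is_coproduct C I A X i" and Y: "is_coproduct C I B Y j"
    and t': "exact_triangle C X Y Z u v w"
    and u: "\<And>k. k \<in> I \<Longrightarrow> u \<cdot> i k = j k \<cdot> f k"
  shows "\<exists>l. is_coproduct C I D Z l"
proof -
  note H' = triangle_Hom[OF t'] triangle_Obj[OF t']
  note H = triangle_Hom[OF t] and HO = triangle_Obj[OF t]
  note i = coproduct_in_Hom[OF X] and j = coproduct_in_Hom[OF Y]
  note SX = Susp_coproduct[OF X HO(1)] and SY = Susp_coproduct[OF Y HO(2)]
  \<comment> \<open>The comparison maps are not unique; any choice will turn out to be a family of
    coproduct injections.\<close>
  have "\<exists>l \<in> Hom C (D k) Z. l \<cdot> g k = v \<cdot> j k \<and> \<Sigma>\<^sub>a C (i k) \<cdot> h k = w \<cdot> l" if "k \<in> I" for k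
    using triangle_morphism[OF t[OF that] t' i[OF that] j[OF that]] u[OF that] by auto
  then obtain l where l: "\<And>k. k \<in> I \<Longrightarrow> l k \<in> Hom C (D k) Z"
    and lg: "\<And>k. k \<in> I \<Longrightarrow> l k \<cdot> g k = v \<cdot> j k"
    and wl: "\<And>k. k \<in> I \<Longrightarrow> w \<cdot> l k = \<Sigma>\<^sub>a C (i k) \<cdot> h k"
    by metis
  \<comment> \<open>Injectivity half of the five lemma, stated for differences: a map that vanishes
    on all \<open>l k\<close> is zero.\<close>
  have unique: "a = Zero C Z W" if a: "a \<in> Hom C Z W" and al: "\<And>k. k \<in> I \<Longrightarrow> a \<cdot> l k = Zero C (D k) W"
    for a W
  proof -
    have W: "W \<in> Obj C" using a by (rule Cod_Obj)
    have "a \<cdot> v = Zero C Y W"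
    proof (rule coproduct_eqI[OF Y Comp_in_Hom[OF H'(2) a] Zero_in_Hom[OF H'(5) W]])
      fix k assume k: "k \<in> I"
      show "(a \<cdot> v) \<cdot> j k = Zero C Y W \<cdot> j k"
        using Comp_assoc[OF j[OF k] H'(2) a] lg[OF k] Comp_assoc[OF H(2)[OF k] l[OF k] a]
          al[OF k] Comp_Zero_left[OF H(2)[OF k] W] Comp_Zero_left[OF j[OF k] W] by simp
    qed
    then obtain b where b: "b \<in> Hom C (\<Sigma>\<^sub>o C X) W" "b \<cdot> w = a"
      by (rule triangle_factor'[OF t' a])
    \<comment> \<open>Vanishing of \<open>a\<close> on \<open>l k\<close> makes \<open>b\<close>
      factor summand by summand through the suspended \<open>f k\<close>. The factors glue to
      \<open>d\<close>, so \<open>b\<close> factors through the suspended \<open>u\<close>, which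
      composes with \<open>w\<close> to zero.\<close>
    have "\<exists>c. c \<in> Hom C (\<Sigma>\<^sub>o C (B k)) W \<and> c \<cdot> \<Sigma>\<^sub>a C (f k) = b \<cdot> \<Sigma>\<^sub>a C (i k)" if k: "k \<in> I" for k
    proof -
      have "(b \<cdot> \<Sigma>\<^sub>a C (i k)) \<cdot> h k = Zero C (D k) W"
        using Comp_assoc[OF H(3)[OF k] Susp_Hom[OF i[OF k]] b(1)] wl[OF k]
          Comp_assoc[OF l[OF k] H'(3) b(1)] b(2) al[OF k] by simp
      then show ?thesis
        using triangle_factor''[OF t[OF k] Comp_in_Hom[OF Susp_Hom[OF i[OF k]] b(1)]] by blast
    qed
    then obtain c where c: "\<And>k. k \<in> I \<Longrightarrow> c k \<in> Hom C (\<Sigma>\<^sub>o C (B k)) W"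
      "\<And>k. k \<in> I \<Longrightarrow> c k \<cdot> \<Sigma>\<^sub>a C (f k) = b \<cdot> \<Sigma>\<^sub>a C (i k)" by metis
    obtain d where d: "d \<in> Hom C (\<Sigma>\<^sub>o C Y) W" "\<And>k. k \<in> I \<Longrightarrow> d \<cdot> \<Sigma>\<^sub>a C (j k) = c k"
      using coproduct_desc[OF SY W c(1)] by blast
    have "d \<cdot> \<Sigma>\<^sub>a C u = b"
    proof (rule coproduct_eqI[OF SX Comp_in_Hom[OF Susp_Hom[OF H'(1)] d(1)] b(1)])
      fix k assume k: "k \<in> I"
      show "(d \<cdot> \<Sigma>\<^sub>a C u) \<cdot> \<Sigma>\<^sub>a C (i k) = b \<cdot> \<Sigma>\<^sub>a C (i k)"
        using Comp_assoc[OF Susp_Hom[OF i[OF k]] Susp_Hom[OF H'(1)] d(1)] Susp_Comp[OF i[OF k] H'(1)]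
          u[OF k] Susp_Comp[OF H(1)[OF k] j[OF k]] d(2)[OF k] c(2)[OF k]
          Comp_assoc[OF Susp_Hom[OF H(1)[OF k]] Susp_Hom[OF j[OF k]] d(1)] by simp
    qed
    then have "a = d \<cdot> (\<Sigma>\<^sub>a C u \<cdot> w)" using b(2) Comp_assoc[OF H'(3) Susp_Hom[OF H'(1)] d(1)] by simp
    then show ?thesis using triangle_comp_zero'[OF t'] Comp_Zero_right[OF d(1) H'(6)] by simp
  qed
  \<comment> \<open>Surjectivity half: extend the family first along \<open>v\<close>, then correct
    the extension.\<close>
  have exist: "\<exists>a. a \<in> Hom C Z W \<and> (\<forall>k\<in>I. a \<cdot> l k = s k)"
    if W: "W \<in> Obj C" and s: "\<And>k. k \<in> I \<Longrightarrow> s k \<in> Hom C (D k) W" for s W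
  proof -
    obtain b where b: "b \<in> Hom C Y W" "\<And>k. k \<in> I \<Longrightarrow> b \<cdot> j k = s k \<cdot> g k"
      by (rule coproduct_desc[OF Y W, of "\<lambda>k. s k \<cdot> g k"]) (use Comp_in_Hom H(2) s in blast)+
    have "b \<cdot> u = Zero C X W"
    proof (rule coproduct_eqI[OF X Comp_in_Hom[OF H'(1) b(1)] Zero_in_Hom[OF H'(4) W]])
      fix k assume k: "k \<in> I"
      show "(b \<cdot> u) \<cdot> i k = Zero C X W \<cdot> i k"
        using Comp_assoc[OF i[OF k] H'(1) b(1)] u[OF k] Comp_assoc[OF H(1)[OF k] j[OF k] b(1)]
          b(2)[OF k] Comp_assoc[OF H(1)[OF k] H(2)[OF k] s[OF k]] triangle_comp_zero[OF t[OF k]]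
          Comp_Zero_right[OF s[OF k] HO(1)[OF k]] Comp_Zero_left[OF i[OF k] W] by simp
    qed
    then obtain a where a: "a \<in> Hom C Z W" "a \<cdot> v = b" by (rule triangle_factor[OF t' b(1)])
    \<comment> \<open>So far \<open>a \<cdot> l k\<close> and \<open>s k\<close> agree only after
      composition with \<open>g k\<close>. Each error factors through \<open>h k\<close>, and the
      glued errors \<open>d\<close> are subtracted from \<open>a\<close> by way of
      \<open>d \<cdot> w\<close>.\<close>
    have "\<exists>c. c \<in> Hom C (\<Sigma>\<^sub>o C (A k)) W \<and> c \<cdot> h k = a \<cdot> l k \<ominus> s k" if k: "k \<in> I" for k
    proof -
      have al: "a \<cdot> l k \<in> Hom C (D k) W" using l[OF k] a(1) by (rule Comp_in_Hom)
      have "(a \<cdot> l k \<ominus> s k) \<cdot> g k = Zero C (B k) W"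
        using Comp_Sub_left[OF H(2)[OF k] al s[OF k]] Comp_assoc[OF H(2)[OF k] l[OF k] a(1)] lg[OF k]
          Comp_assoc[OF j[OF k] H'(2) a(1)] a(2) b(2)[OF k] Sub_self[OF Comp_in_Hom[OF H(2)[OF k] s[OF k]]]
        by simp
      then show ?thesis
        using triangle_factor'[OF t[OF k] Sub_in_Hom[OF al s[OF k]]] by blast
    qed
    then obtain c where c: "\<And>k. k \<in> I \<Longrightarrow> c k \<in> Hom C (\<Sigma>\<^sub>o C (A k)) W"
      "\<And>k. k \<in> I \<Longrightarrow> c k \<cdot> h k = a \<cdot> l k \<ominus> s k" by metis
    obtain d where d: "d \<in> Hom C (\<Sigma>\<^sub>o C X) W" "\<And>k. k \<in> I \<Longrightarrow> d \<cdot> \<Sigma>\<^sub>a C (i k) = c k"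
      using coproduct_desc[OF SX W c(1)] by blast
    have dw: "d \<cdot> w \<in> Hom C Z W" using H'(3) d(1) by (rule Comp_in_Hom)
    have "(a \<ominus> d \<cdot> w) \<cdot> l k = s k" if k: "k \<in> I" for k
    proof -
      have "(d \<cdot> w) \<cdot> l k = a \<cdot> l k \<ominus> s k"
        using Comp_assoc[OF l[OF k] H'(3) d(1)] wl[OF k] d(2)[OF k] c(2)[OF k]
          Comp_assoc[OF H(3)[OF k] Susp_Hom[OF i[OF k]] d(1)] by simp
      then show ?thesis
        using Comp_Sub_left[OF l[OF k] a(1) dw] Sub_Sub_cancel[OF Comp_in_Hom[OF l[OF k] a(1)] s[OF k]]
        by simp
    qed
    then show ?thesis using Sub_in_Hom[OF a(1) dw] by blast
  qed
  have "is_coproduct C I D Z l"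
    unfolding is_coproduct_def
  proof (intro conjI ballI allI impI)
    fix W s assume W: "W \<in> Obj C" and s: "\<forall>k\<in>I. s k \<in> Hom C (D k) W"
    obtain a where a: "a \<in> Hom C Z W" "\<And>k. k \<in> I \<Longrightarrow> a \<cdot> l k = s k" using exist W s by blast
    show "\<exists>!a. a \<in> Hom C Z W \<and> (\<forall>k\<in>I. a \<cdot> l k = s k)"
    proof (intro ex1I[of _ a] conjI ballI)
      fix a' assume a': "a' \<in> Hom C Z W \<and> (\<forall>k\<in>I. a' \<cdot> l k = s k)"
      have "a' \<ominus> a = Zero C Z W"
      proof (rule unique)
        show "a' \<ominus> a \<in> Hom C Z W" using a' a(1) Sub_in_Hom by blast
        show "(a' \<ominus> a) \<cdot> l k = Zero C (D k) W" if k: "k \<in> I" for k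
          using Comp_Sub_left[OF l[OF k] _ a(1)] a' a(2)[OF k] Sub_self k s by simp
      qed
      then show "a' = a" using a a' Sub_eq_Zero_iff by blast
    qed (use a in auto)
  qed (use H' l in auto)
  then show ?thesis by blast
qed

end

section \<open>Triangulated subcategories\<close>

lemma triangulated_subcategoryD:
  assumes "triangulated_subcategory C U"
  shows "A \<in> U \<Longrightarrow> A \<in> Obj C"
    and "zero_object C Z \<Longrightarrow> Z \<in> U"
    and "A \<in> U \<Longrightarrow> iso_arrow C A B f \<Longrightarrow> B \<in> U"
    and "A \<in> Obj C \<Longrightarrow> \<Sigma>\<^sub>o C A \<in> U \<longleftrightarrow> A \<in> U"
    and "exact_triangle C X Y Z f g h \<Longrightarrow> X \<in> U \<Longrightarrow> Y \<in> U \<Longrightarrow> Z \<in> U"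
  using assms unfolding triangulated_subcategory_def by blast+

lemma localizing_subcategoryD:
  assumes "localizing_subcategory C U"
  shows "triangulated_subcategory C U"
    and "\<And>(I :: nat set) A. is_coproduct C I A B j \<Longrightarrow> (\<And>k. k \<in> I \<Longrightarrow> A k \<in> U) \<Longrightarrow> B \<in> U"
  using assms unfolding localizing_subcategory_def by blast+

text \<open>The hypothesis on \<open>U\<close> makes the intersected family nonempty; an empty
  intersection would be the whole type instead of a set of objects.\<close>

lemma localizing_generated_localizing:
  assumes "localizing_subcategory C U" "G \<subseteq> U"
  shows "localizing_subcategory C (localizing_generated C G)"
proof -
  let ?F = "{U. localizing_subcategory C U \<and> G \<subseteq> U}"
  have U: "U \<in> ?F" using assms by simp
  have tri: "triangulated_subcategory C V" if "V \<in> ?F" for V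
    using that localizing_subcategoryD(1) by blast
  note D = triangulated_subcategoryD[OF tri]
  have "triangulated_subcategory C (\<Inter>?F)"
    unfolding triangulated_subcategory_def
  proof (intro conjI allI impI ballI)
    show "\<Inter>?F \<subseteq> Obj C" using D(1)[OF U] U by blast
    show "Z \<in> \<Inter>?F" if "zero_object C Z" for Z using D(2)[OF _ that] by (rule InterI)
    show "B \<in> \<Inter>?F" if "A \<in> \<Inter>?F \<and> iso_arrow C A B f" for A B f
    proof (rule InterI)
      fix V assume "V \<in> ?F"
      then show "B \<in> V" using D(3)[of V A B f] that by blast
    qed
    show "\<Sigma>\<^sub>o C A \<in> \<Inter>?F \<longleftrightarrow> A \<in> \<Inter>?F" if "A \<in> Obj C" for A
      unfolding Inter_iff using D(4)[OF _ that] by (intro ball_cong refl)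
    show "Z \<in> \<Inter>?F" if "exact_triangle C X Y Z f g h \<and> X \<in> \<Inter>?F \<and> Y \<in> \<Inter>?F" for X Y Z f g h
    proof (rule InterI)
      fix V assume "V \<in> ?F"
      then show "Z \<in> V" using D(5)[of V X Y Z f g h] that by blast
    qed
  qed
  moreover have "B \<in> \<Inter>?F" if A: "\<forall>k\<in>I. A k \<in> \<Inter>?F" and B: "is_coproduct C I A B j"
    for I :: "nat set" and A B j
  proof (rule InterI)
    fix V assume V: "V \<in> ?F"
    then have "localizing_subcategory C V" by simp
    then show "B \<in> V" by (rule localizing_subcategoryD(2)[OF _ B]) (use A V in blast)
  qed
  ultimately show ?thesis
    unfolding localizing_generated_def localizing_subcategory_def[of C "\<Inter>?F"] by metis
qed

section \<open>Left orthogonal subcategories\<close>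

definition left_orthogonal :: "('o, 'm, 'z) preadd_cat_scheme \<Rightarrow> 'o set \<Rightarrow> 'o set" where
  "left_orthogonal C N = {A \<in> Obj C. \<forall>B \<in> N. Hom C A B \<subseteq> {Zero C A B}}"

lemma left_orthogonalD:
  assumes "A \<in> left_orthogonal C N"
  shows "A \<in> Obj C" "B \<in> N \<Longrightarrow> f \<in> Hom C A B \<Longrightarrow> f = Zero C A B"
  using assms by (auto simp: left_orthogonal_def)

lemma left_orthogonalI:
  assumes "A \<in> Obj C" "\<And>B f. B \<in> N \<Longrightarrow> f \<in> Hom C A B \<Longrightarrow> f = Zero C A B"
  shows "A \<in> left_orthogonal C N"
  using assms by (auto simp: left_orthogonal_def)

text \<open>Every \<open>f\<close> on \<open>A\<close> equals
  \<open>(f \<cdot> p) \<cdot> i\<close>, and \<open>f \<cdot> p\<close> starts at \<open>B\<close>.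
  This gives closure under isomorphism and, later, thickness.\<close>

lemma (in preadditive_category) left_orthogonal_retract:
  assumes L: "B \<in> left_orthogonal C N" and i: "i \<in> Hom C A B" and p: "p \<in> Hom C B A"
    and pi: "p \<cdot> i = Ident C A"
  shows "A \<in> left_orthogonal C N"
proof (rule left_orthogonalI)
  show "A \<in> Obj C" using i by (rule Dom_Obj)
  fix M f assume M: "M \<in> N" and f: "f \<in> Hom C A M"
  have "f \<cdot> p = Zero C B M" using left_orthogonalD(2)[OF L M Comp_in_Hom[OF p f]] .
  moreover have "(f \<cdot> p) \<cdot> i = f" using Comp_assoc[OF i p f] pi Comp_Id_right[OF f] by simp
  ultimately show "f = Zero C A M" using Comp_Zero_left[OF i Cod_Obj[OF f]] by simp
qed

context triangulated_category
begin

text \<open>For fixed \<open>M\<close>, maps into \<open>M\<close> are exact on triangles and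
  determined on summands. Shifts of the source are traded for shifts of the target, which stay in
  \<open>N\<close>.\<close>

lemma left_orthogonal_localizing:
  assumes N: "triangulated_subcategory C N"
  shows "localizing_subcategory C (left_orthogonal C N)"
proof -
  let ?L = "left_orthogonal C N"
  note N' = triangulated_subcategoryD[OF N]
  have susp: "\<Sigma>\<^sub>o C A \<in> ?L" if L: "A \<in> ?L" for A
  proof -
    have A: "A \<in> Obj C" using L by (rule left_orthogonalD(1))
    show ?thesis
    proof (rule left_orthogonalI[OF Susp_Obj[OF A]])
      fix M f assume M: "M \<in> N" and f: "f \<in> Hom C (\<Sigma>\<^sub>o C A) M"
      \<comment> \<open>The target is desuspended inside \<open>N\<close>, up to isomorphism, so
        that \<open>f\<close> comes from a map on \<open>A\<close> itself.\<close>
      obtain M' u where M': "M' \<in> Obj C" "iso_arrow C (\<Sigma>\<^sub>o C M') M u"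
        using Susp_surj[OF Cod_Obj[OF f]] .
      obtain v where u: "u \<in> Hom C (\<Sigma>\<^sub>o C M') M" and v: "v \<in> Hom C M (\<Sigma>\<^sub>o C M')"
        and vu: "v \<cdot> u = Ident C (\<Sigma>\<^sub>o C M')" and uv: "u \<cdot> v = Ident C M"
        using M'(2) by (rule iso_arrowE)
      have "iso_arrow C M (\<Sigma>\<^sub>o C M') v" using u v vu uv by (auto simp: iso_arrow_def)
      then have M'N: "M' \<in> N" using N'(3)[OF M] N'(4)[OF M'(1)] by simp
      obtain g where g: "g \<in> Hom C A M'" "\<Sigma>\<^sub>a C g = v \<cdot> f"
        by (rule Susp_full[OF A M'(1) Comp_in_Hom[OF f v]])
      have "v \<cdot> f = Zero C (\<Sigma>\<^sub>o C A) (\<Sigma>\<^sub>o C M')"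
        using g left_orthogonalD(2)[OF L M'N g(1)] Susp_Zero[OF A M'(1)] by simp
      moreover have "u \<cdot> (v \<cdot> f) = f" using Comp_assoc[OF f v u, symmetric] uv Comp_Id_left[OF f] by simp
      ultimately show "f = Zero C (\<Sigma>\<^sub>o C A) M" using Comp_Zero_right[OF u Susp_Obj[OF A]] by simp
    qed
  qed
  have "triangulated_subcategory C ?L"
    unfolding triangulated_subcategory_def
  proof (intro conjI allI impI ballI)
    show "?L \<subseteq> Obj C" by (auto simp: left_orthogonal_def)
    show "Z \<in> ?L" if Z: "zero_object C Z" for Z
    proof (rule left_orthogonalI)
      show "Z \<in> Obj C" using Z by (simp add: zero_object_iff)
      show "f = Zero C Z M" if "f \<in> Hom C Z M" for M f
        by (rule Hom_from_zero[OF _ that]) (use Z in \<open>simp add: zero_object_iff\<close>)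
    qed
    show "B \<in> ?L" if "A \<in> ?L \<and> iso_arrow C A B f" for A B f
    proof -
      have A: "A \<in> ?L" and f: "iso_arrow C A B f" using that by auto
      obtain g where "f \<in> Hom C A B" "g \<in> Hom C B A" "f \<cdot> g = Ident C B" using f by (rule iso_arrowE)
      then show ?thesis using left_orthogonal_retract[OF A] by blast
    qed
    fix A assume A: "A \<in> Obj C"
    show "\<Sigma>\<^sub>o C A \<in> ?L \<longleftrightarrow> A \<in> ?L"
    proof
      assume S: "\<Sigma>\<^sub>o C A \<in> ?L"
      show "A \<in> ?L"
      proof (rule left_orthogonalI[OF A])
        fix M f assume M: "M \<in> N" and f: "f \<in> Hom C A M"
        have MO: "M \<in> Obj C" using f by (rule Cod_Obj)
        have "\<Sigma>\<^sub>a C f = \<Sigma>\<^sub>a C (Zero C A M)"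
          using left_orthogonalD(2)[OF S _ Susp_Hom[OF f]] N'(4)[OF MO] M Susp_Zero[OF A MO] by simp
        then show "f = Zero C A M" by (rule Susp_faithful[OF f Zero_in_Hom[OF A MO]])
      qed
    next
      show "\<Sigma>\<^sub>o C A \<in> ?L" if "A \<in> ?L" using that by (rule susp)
    qed
  next
    fix X Y Z f g h assume *: "exact_triangle C X Y Z f g h \<and> X \<in> ?L \<and> Y \<in> ?L"
    then have t: "exact_triangle C X Y Z f g h" by simp
    note H = triangle_Hom[OF t] triangle_Obj[OF t]
    show "Z \<in> ?L"
    proof (rule left_orthogonalI[OF H(6)])
      fix M a assume M: "M \<in> N" and a: "a \<in> Hom C Z M"
      have "a \<cdot> g = Zero C Y M" using * left_orthogonalD(2)[OF _ M Comp_in_Hom[OF H(2) a]] by simp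
      then obtain b where b: "b \<in> Hom C (\<Sigma>\<^sub>o C X) M" "b \<cdot> h = a" by (rule triangle_factor'[OF t a])
      then show "a = Zero C Z M"
        using left_orthogonalD(2)[OF susp M b(1)] * Comp_Zero_left[OF H(3) Cod_Obj[OF a]] by simp
    qed
  qed
  moreover have "B \<in> ?L" if A: "\<forall>k\<in>I. A k \<in> ?L" and B: "is_coproduct C I A B j"
    for I :: "nat set" and A B j
  proof (rule left_orthogonalI)
    show BO: "B \<in> Obj C" using B by (simp add: is_coproduct_def)
    fix M f assume M: "M \<in> N" and f: "f \<in> Hom C B M"
    show "f = Zero C B M"
    proof (rule coproduct_eqI[OF B f Zero_in_Hom[OF BO Cod_Obj[OF f]]])
      fix k assume k: "k \<in> I"
      show "f \<cdot> j k = Zero C B M \<cdot> j k"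
        using left_orthogonalD(2)[OF A[rule_format, OF k] M Comp_in_Hom[OF coproduct_in_Hom[OF B k] f]]
          Comp_Zero_left[OF coproduct_in_Hom[OF B k] Cod_Obj[OF f]] by simp
    qed
  qed
  ultimately show ?thesis by (auto simp: localizing_subcategory_def)
qed

section \<open>Triangles relative to a subcategory, and morphisms with cone in it\<close>

lemma iso_arrow_inverse:
  assumes "iso_arrow C A B f" shows "\<exists>g. iso_arrow C B A g"
  using assms by (auto simp: iso_arrow_def)

lemma triangle_first_in:
  assumes U: "triangulated_subcategory C U" and t: "exact_triangle C X Y Z f g h"
    and YZ: "Y \<in> U" "Z \<in> U"
  shows "X \<in> U"
  using triangulated_subcategoryD(5)[OF U rotate[OF t] YZ] triangulated_subcategoryD(4)[OF U]
    triangle_Obj(1)[OF t] by blast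

lemma triangle_middle_in:
  assumes U: "triangulated_subcategory C U" and t: "exact_triangle C X Y Z f g h"
    and XZ: "X \<in> U" "Z \<in> U"
  shows "Y \<in> U"
  using triangle_first_in[OF U rotate[OF t] XZ(2)] triangulated_subcategoryD(4)[OF U]
    triangle_Obj(1)[OF t] XZ(1) by blast

lemma triangle_cone_iso:
  assumes t: "exact_triangle C X Y Z f g h" and w: "iso_arrow C Z Z' w"
  shows "\<exists>g' h'. exact_triangle C X Y Z' f g' h'"
proof -
  note H = triangle_Hom[OF t] triangle_Obj[OF t]
  obtain w' where w': "w \<in> Hom C Z Z'" "w' \<in> Hom C Z' Z" "w' \<cdot> w = Ident C Z" "w \<cdot> w' = Ident C Z'"
    using w by (rule iso_arrowE)
  have "exact_triangle C X Y Z' f (w \<cdot> g) (h \<cdot> w')"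
  proof (rule triangle_iso[OF t H(1) Comp_in_Hom[OF H(2) w'(1)] Comp_in_Hom[OF w'(2) H(3)]
        iso_arrow_Ident[OF H(4)] iso_arrow_Ident[OF H(5)] w])
    show "Ident C Y \<cdot> f = f \<cdot> Ident C X" using Comp_Id_left Comp_Id_right H(1) by simp
    show "w \<cdot> g = (w \<cdot> g) \<cdot> Ident C Y"
      using Comp_Id_right[OF Comp_in_Hom[OF H(2) w'(1)]] by simp
    show "\<Sigma>\<^sub>a C (Ident C X) \<cdot> h = (h \<cdot> w') \<cdot> w"
      using Comp_assoc[OF w'(1,2) H(3)] w'(3) Comp_Id_right[OF H(3)] Comp_Id_left[OF H(3)]
        Susp_Ident[OF H(4)] by simp
  qed
  then show ?thesis by blast
qed

text \<open>Desuspends the cone: \<open>Z\<close> is replaced by an isomorphic suspension of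
  \<open>P\<close>, the third map is lifted by fullness, and its negative compensates the sign of
  rotation.\<close>

lemma triangle_fibre:
  assumes U: "triangulated_subcategory C U" and t: "exact_triangle C X Y Z f g h" and Z: "Z \<in> U"
  shows "\<exists>P\<in>U. \<exists>p q. exact_triangle C P X Y p f q"
proof -
  note H = triangle_Hom[OF t] triangle_Obj[OF t]
  obtain P u where P: "P \<in> Obj C" "iso_arrow C (\<Sigma>\<^sub>o C P) Z u" using Susp_surj[OF H(6)] .
  obtain w where w: "iso_arrow C Z (\<Sigma>\<^sub>o C P) w" using iso_arrow_inverse[OF P(2)] by blast
  have PU: "P \<in> U"
    using triangulated_subcategoryD(3)[OF U Z w] triangulated_subcategoryD(4)[OF U P(1)] by blast
  obtain g' h' where t': "exact_triangle C X Y (\<Sigma>\<^sub>o C P) f g' h'" using triangle_cone_iso[OF t w] by blast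
  note H' = triangle_Hom[OF t']
  obtain p where p: "p \<in> Hom C P X" "\<Sigma>\<^sub>a C p = h'" by (rule Susp_full[OF P(1) H(4) H'(3)])
  have "Neg C (\<Sigma>\<^sub>o C P) (\<Sigma>\<^sub>o C X) (\<Sigma>\<^sub>a C (Neg C P X p)) = h'"
    using Susp_Neg[OF p(1)] Neg_Neg[OF Susp_Hom[OF p(1)]] p(2) by simp
  then have "exact_triangle C P X Y (Neg C P X p) f g'"
    using triangle_rotate[OF Neg_in_Hom[OF p(1)] H'(1,2)] t' by simp
  then show ?thesis using PU by blast
qed

text \<open>The class of morphisms inverted in the Verdier quotient by \<open>U\<close>. The
  triangle also records that \<open>f\<close> is a morphism from \<open>X\<close> to
  \<open>Y\<close>.\<close>

definition cone_in :: "'o set \<Rightarrow> 'o \<Rightarrow> 'o \<Rightarrow> 'm \<Rightarrow> bool" where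
  "cone_in U X Y f \<longleftrightarrow> (\<exists>Z\<in>U. \<exists>g h. exact_triangle C X Y Z f g h)"

lemma cone_in_Ident:
  assumes U: "triangulated_subcategory C U" and X: "X \<in> Obj C"
  shows "cone_in U X X (Ident C X)"
proof -
  obtain Z where "zero_object C Z" by (rule zero_object_exists)
  then show ?thesis
    using triangle_Id[OF X] triangulated_subcategoryD(2)[OF U] unfolding cone_in_def by blast
qed

text \<open>The octahedral axiom places the cone of the composite between the cones of the two
  factors.\<close>

lemma cone_in_Comp:
  assumes U: "triangulated_subcategory C U" and f: "cone_in U X Y f" and g: "cone_in U Y Z g"
  shows "cone_in U X Z (g \<cdot> f)"
proof -
  obtain A f1 f2 where A: "A \<in> U" "exact_triangle C X Y A f f1 f2"
    using f by (auto simp: cone_in_def)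
  obtain B g1 g2 where B: "B \<in> U" "exact_triangle C Y Z B g g1 g2"
    using g by (auto simp: cone_in_def)
  obtain V k1 k2 where V: "exact_triangle C X Z V (g \<cdot> f) k1 k2"
    using triangle_exists[OF Comp_in_Hom[OF triangle_Hom(1)[OF A(2)] triangle_Hom(1)[OF B(2)]]] by blast
  obtain a b where "exact_triangle C A V B a b (\<Sigma>\<^sub>a C f1 \<cdot> g2)"
    using octahedral[OF A(2) B(2) V] by blast
  then have "V \<in> U" using triangle_middle_in[OF U] A(1) B(1) by blast
  then show ?thesis using V by (auto simp: cone_in_def)
qed

section \<open>Telescopes and homotopy colimits\<close>

text \<open>Here \<open>s\<close> is \<open>1 - shift\<close> on a countable sum of copies of
  \<open>A\<close>. It is a split monomorphism whose complement is \<open>A\<close>, with the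
  codiagonal \<open>p\<close> as projection and \<open>i 0\<close> as inclusion.\<close>

lemma cone_telescope_constant:
  assumes X: "is_coproduct C (UNIV :: nat set) (\<lambda>_. A) X i" and A: "A \<in> Obj C"
    and s: "s \<in> Hom C X X" "\<And>k. s \<cdot> i k = i k \<ominus> i (Suc k)"
    and t: "exact_triangle C X X Z s g h"
  shows "\<exists>w. iso_arrow C Z A w"
proof -
  have i: "i k \<in> Hom C A X" for k using coproduct_in_Hom[OF X] by simp
  have XO: "X \<in> Obj C" using s(1) by (rule Dom_Obj)
  obtain p where p: "p \<in> Hom C X A" "\<And>k. p \<cdot> i k = Ident C A"
    by (rule coproduct_desc[OF X A, of "\<lambda>_. Ident C A"]) (auto simp: Id_in_Hom A)
  \<comment> \<open>A retraction \<open>r\<close> with values \<open>q k\<close> on the summands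
    needs \<open>q k \<ominus> q (Suc k) = i k\<close>. Starting at zero gives minus the sum of
    \<open>i 0\<close> up to \<open>i (k - 1)\<close>; this start is what makes the complementary
    idempotent equal to \<open>i 0 \<cdot> p\<close>.\<close>
  define q where "q = rec_nat (Zero C A X) (\<lambda>k r. r \<ominus> i k)"
  have q_simps: "q 0 = Zero C A X" "q (Suc k) = q k \<ominus> i k" for k by (simp_all add: q_def)
  have qH: "q k \<in> Hom C A X" for k
    by (induction k) (simp_all add: q_simps Zero_in_Hom A XO Sub_in_Hom i)
  obtain r where r: "r \<in> Hom C X X" "\<And>k. r \<cdot> i k = q k"
    by (rule coproduct_desc[OF X XO, of q]) (auto simp: qH)
  have sq: "s \<cdot> q k = i k \<ominus> i 0" for k
  proof (induction k)
    case 0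
    then show ?case using Comp_Zero_right[OF s(1) A] Sub_self[OF i] by (simp add: q_simps)
  next
    case (Suc k)
    then show ?case
      using Comp_Sub_right[OF qH i s(1), of k k] s(2)[of k] Sub_Sub_Sub[OF i i i, of k 0 "Suc k"]
      by (simp add: q_simps)
  qed
  show ?thesis
  proof (rule cone_split_mono[OF t r(1) _ p(1) i p(2)])
    show "r \<cdot> s = Ident C X"
    proof (rule coproduct_eqI[OF X Comp_in_Hom[OF s(1) r(1)] Id_in_Hom[OF XO]])
      fix k
      have "r \<cdot> (i k \<ominus> i (Suc k)) = i k"
        using Comp_Sub_right[OF i i r(1), of k "Suc k"] r(2) q_simps(2) Sub_Sub_cancel[OF qH i] by simp
      then show "(r \<cdot> s) \<cdot> i k = Ident C X \<cdot> i k"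
        using Comp_assoc[OF i s(1) r(1)] s(2) Comp_Id_left[OF i] by simp
    qed
    show "p \<cdot> s = Zero C X A"
    proof (rule coproduct_eqI[OF X Comp_in_Hom[OF s(1) p(1)] Zero_in_Hom[OF XO A]])
      fix k
      have "p \<cdot> (i k \<ominus> i (Suc k)) = Zero C A A"
        using Comp_Sub_right[OF i i p(1), of k "Suc k"] p(2) Sub_self[OF Id_in_Hom[OF A]] by simp
      then show "(p \<cdot> s) \<cdot> i k = Zero C X A \<cdot> i k"
        using Comp_assoc[OF i s(1) p(1)] s(2) Comp_Zero_left[OF i A] by simp
    qed
    have sr: "s \<cdot> r \<in> Hom C X X" using r(1) s(1) by (rule Comp_in_Hom)
    show "i 0 \<cdot> p = Ident C X \<ominus> s \<cdot> r"
    proof (rule coproduct_eqI[OF X Comp_in_Hom[OF p(1) i] Sub_in_Hom[OF Id_in_Hom[OF XO] sr]])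
      fix k
      have "(Ident C X \<ominus> s \<cdot> r) \<cdot> i k = i k \<ominus> (i k \<ominus> i 0)"
        using Comp_Sub_left[OF i Id_in_Hom[OF XO] sr] Comp_Id_left[OF i] Comp_assoc[OF i r(1) s(1)]
          r(2) sq by simp
      then show "(i 0 \<cdot> p) \<cdot> i k = (Ident C X \<ominus> s \<cdot> r) \<cdot> i k"
        using Sub_Sub_cancel[OF i i] Comp_assoc[OF i p(1) i] p(2) Comp_Id_right[OF i] by simp
    qed
  qed
qed

end

lemma has_countable_sumsD:
  assumes "has_countable_sums C" "\<And>k. A k \<in> Obj C"
  obtains X j where "is_coproduct C (UNIV :: nat set) A X j"
proof -
  have "\<exists>X j. is_coproduct C (UNIV :: nat set) A X j"
    using assms by (simp add: has_countable_sums_def)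
  then show ?thesis using that by blast
qed

context triangulated_category
begin

text \<open>Compare the telescope of \<open>N\<close> with that of the constant sequence \<open>N 0\<close>, whose homotopy
  colimit is \<open>N 0\<close>: the octahedral axiom for both factorisations of the diagonal of the
  comparison square gives \<open>N 0 \<rightarrow> V \<rightarrow> M\<close>, both maps having cone in \<open>K\<close>.\<close>

lemma telescope:
  assumes sums: "has_countable_sums C" and K: "localizing_subcategory C K"
    and io: "\<And>n. cone_in K (N n) (N (Suc n)) (io n)"
  obtains Y j t M g h f where "is_coproduct C (UNIV :: nat set) N Y j"
    and "t \<in> Hom C Y Y" "\<And>k. t \<cdot> j k = j k \<ominus> j (Suc k) \<cdot> io k"
    and "exact_triangle C Y Y M t g h" and "cone_in K (N 0) M f"
proof -
  note K' = localizing_subcategoryD(1)[OF K]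
  have ioH: "io n \<in> Hom C (N n) (N (Suc n))" for n
    using io[of n] unfolding cone_in_def by (blast dest: triangle_Hom(1))
  have NO: "N n \<in> Obj C" for n using ioH[of n] by (rule Dom_Obj)
  define A where "A = N 0"
  have A: "A \<in> Obj C" using NO by (simp add: A_def)
  \<comment> \<open>The composites \<open>N 0 \<rightarrow> N k\<close>, whose cones lie in
    \<open>K\<close> by induction.\<close>
  define i where "i = rec_nat (Ident C A) (\<lambda>k a. io k \<cdot> a)"
  have i_simps: "i 0 = Ident C A" "i (Suc k) = io k \<cdot> i k" for k by (simp_all add: i_def)
  have ik: "cone_in K A (N k) (i k)" for k
  proof (induction k)
    case 0
    then show ?case using cone_in_Ident[OF K' A] by (simp add: i_simps A_def)
  next
    case (Suc k)
    then show ?case using cone_in_Comp[OF K' Suc io] by (simp add: i_simps)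
  qed
  then obtain D i1 i2 where D: "\<And>k. D k \<in> K" "\<And>k. exact_triangle C A (N k) (D k) (i k) (i1 k) (i2 k)"
    unfolding cone_in_def by metis
  note iH = triangle_Hom(1)[OF D(2)]
  obtain X e where X: "is_coproduct C (UNIV :: nat set) (\<lambda>_. A) X e"
    by (rule has_countable_sumsD[OF sums A])
  obtain Y j where Y: "is_coproduct C (UNIV :: nat set) N Y j"
    by (rule has_countable_sumsD[OF sums NO])
  have XO: "X \<in> Obj C" and YO: "Y \<in> Obj C" using X Y by (simp_all add: is_coproduct_def)
  have e: "e k \<in> Hom C A X" for k using coproduct_in_Hom[OF X] by simp
  have j: "j k \<in> Hom C (N k) Y" for k using coproduct_in_Hom[OF Y] by simp
  have jio: "j (Suc k) \<cdot> io k \<in> Hom C (N k) Y" for k using ioH j by (rule Comp_in_Hom)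
  obtain s where s: "s \<in> Hom C X X" "\<And>k. s \<cdot> e k = e k \<ominus> e (Suc k)"
    by (rule coproduct_desc[OF X XO, of "\<lambda>k. e k \<ominus> e (Suc k)"]) (auto simp: e Sub_in_Hom)
  obtain t where t: "t \<in> Hom C Y Y" "\<And>k. t \<cdot> j k = j k \<ominus> j (Suc k) \<cdot> io k"
    by (rule coproduct_desc[OF Y YO, of "\<lambda>k. j k \<ominus> j (Suc k) \<cdot> io k"])
      (auto simp: j jio Sub_in_Hom)
  \<comment> \<open>The sum of the composites \<open>i k\<close>; it intertwines the two telescope
    maps \<open>s\<close> and \<open>t\<close>.\<close>
  obtain c where c: "c \<in> Hom C X Y" "\<And>k. c \<cdot> e k = j k \<cdot> i k"
    by (rule coproduct_desc[OF X YO, of "\<lambda>k. j k \<cdot> i k"]) (auto intro: Comp_in_Hom[OF iH j])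
  have cs_tc: "c \<cdot> s = t \<cdot> c"
  proof (rule coproduct_eqI[OF X Comp_in_Hom[OF s(1) c(1)] Comp_in_Hom[OF c(1) t(1)]])
    fix k
    have "(c \<cdot> s) \<cdot> e k = j k \<cdot> i k \<ominus> j (Suc k) \<cdot> (io k \<cdot> i k)"
      using Comp_assoc[OF e s(1) c(1), of k] Comp_Sub_right[OF e e c(1), of k "Suc k"] c(2) s(2)
      by (simp add: i_simps)
    moreover have "(t \<cdot> c) \<cdot> e k = j k \<cdot> i k \<ominus> j (Suc k) \<cdot> (io k \<cdot> i k)"
      using Comp_assoc[OF e c(1) t(1), of k] c(2) Comp_assoc[OF iH j t(1), of k] t(2)
        Comp_Sub_left[OF iH j jio, of k] Comp_assoc[OF iH ioH j, of k] by simp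
    ultimately show "(c \<cdot> s) \<cdot> e k = (t \<cdot> c) \<cdot> e k" by simp
  qed
  obtain Z s1 s2 where sZ: "exact_triangle C X X Z s s1 s2" using triangle_exists[OF s(1)] by blast
  obtain w where "iso_arrow C Z A w" using cone_telescope_constant[OF X A s sZ] by blast
  then obtain s1 s2 where sA: "exact_triangle C X X A s s1 s2" using triangle_cone_iso[OF sZ] by blast
  obtain Q c1 c2 where cQ: "exact_triangle C X Y Q c c1 c2" using triangle_exists[OF c(1)] by blast
  \<comment> \<open>The cone of \<open>c\<close> is the sum of the cones of the \<open>i k\<close>,
    hence in \<open>K\<close>.\<close>
  obtain l where l: "is_coproduct C (UNIV :: nat set) D Q l"
    using cone_coproduct[OF D(2) X Y cQ c(2)] by blast
  have Q: "Q \<in> K" using localizing_subcategoryD(2)[OF K l] D(1) .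
  \<comment> \<open>\<open>V\<close> is the cone of the common diagonal. Factoring it as
    \<open>c \<cdot> s\<close> yields a triangle on \<open>A\<close>, \<open>V\<close>,
    \<open>Q\<close>; factoring it as \<open>t \<cdot> c\<close> yields one on \<open>Q\<close>,
    \<open>V\<close>, \<open>M\<close>.\<close>
  obtain M g h where tM: "exact_triangle C Y Y M t g h" using triangle_exists[OF t(1)] by blast
  obtain V k1 k2 where V: "exact_triangle C X Y V (c \<cdot> s) k1 k2"
    using triangle_exists[OF Comp_in_Hom[OF s(1) c(1)]] by blast
  obtain a b where a: "exact_triangle C A V Q a b (\<Sigma>\<^sub>a C s1 \<cdot> c2)"
    using octahedral[OF sA cQ V] by blast
  have V': "exact_triangle C X Y V (t \<cdot> c) k1 k2" using V cs_tc by simp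
  obtain a' b' where b': "exact_triangle C Q V M a' b' (\<Sigma>\<^sub>a C c1 \<cdot> h)"
    using octahedral[OF cQ tM V'] by blast
  \<comment> \<open>In the second triangle \<open>Q\<close> is the first term, so the cone of
    \<open>V \<rightarrow> M\<close> is its suspension.\<close>
  have "\<Sigma>\<^sub>o C Q \<in> K" using triangulated_subcategoryD(4)[OF K' triangulated_subcategoryD(1)[OF K' Q]] Q by simp
  then have "cone_in K V M b'" using rotate[OF b'] unfolding cone_in_def by blast
  moreover have "cone_in K A V a" using a Q unfolding cone_in_def by blast
  ultimately have "cone_in K (N 0) M (b' \<cdot> a)" using cone_in_Comp[OF K'] A_def by blast
  then show ?thesis by (rule that[OF Y t tM])
qed

text \<open>The first member of such a pair is the left orthogonal of the second, hence thick.\<close>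

lemma complementaryI:
  assumes L: "triangulated_subcategory C L" and N: "thick_subcategory C N"
    and perp: "L \<subseteq> left_orthogonal C N"
    and tri: "\<And>A. A \<in> Obj C \<Longrightarrow> \<exists>P\<in>L. \<exists>Q\<in>N. \<exists>f g h. exact_triangle C P A Q f g h"
  shows "complementary C L N"
proof -
  have N': "triangulated_subcategory C N" using N by (simp add: thick_subcategory_def)
  \<comment> \<open>For \<open>A\<close> in the left orthogonal the map
    \<open>A \<rightarrow> Q\<close> vanishes, so the identity of \<open>Q\<close> factors through
    the suspension of \<open>P\<close>, from which all maps to \<open>Q\<close> are zero. Hence
    \<open>Q\<close> is zero and \<open>A\<close> lies between two members of
    \<open>L\<close>.\<close>
  have conv: "A \<in> L" if A: "A \<in> left_orthogonal C N" for A
  proof -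
    obtain P Q f g h where P: "P \<in> L" and Q: "Q \<in> N" and t: "exact_triangle C P A Q f g h"
      using tri left_orthogonalD(1)[OF A] by blast
    note H = triangle_Hom[OF t] triangle_Obj[OF t]
    have "Ident C Q \<cdot> g = Zero C A Q"
      using left_orthogonalD(2)[OF A Q H(2)] Comp_Id_left[OF H(2)] by simp
    then obtain b where b: "b \<in> Hom C (\<Sigma>\<^sub>o C P) Q" "b \<cdot> h = Ident C Q"
      by (rule triangle_factor'[OF t Id_in_Hom[OF H(6)]])
    have "\<Sigma>\<^sub>o C P \<in> left_orthogonal C N"
      using triangulated_subcategoryD(4)[OF L H(4)] P perp by blast
    then have "Ident C Q = Zero C Q Q"
      using left_orthogonalD(2)[OF _ Q b(1)] b(2) Comp_Zero_left[OF H(3,6)] by simp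
    then have "Q \<in> L" using triangulated_subcategoryD(2)[OF L] H(6) by (simp add: zero_object_iff)
    then show ?thesis using triangle_middle_in[OF L t P] by blast
  qed
  have "A \<in> L" if A: "A \<in> Obj C" "A' \<in> Obj C" and B: "B \<in> L"
    and j: "is_coproduct C (UNIV :: bool set) (\<lambda>b. if b then A else A') B j" for A A' B j
  proof -
    obtain p where "j True \<in> Hom C A B" "p \<in> Hom C B A" "p \<cdot> j True = Ident C A"
      by (rule coproduct_bool_retract[OF j A])
    then have "A \<in> left_orthogonal C N" by (rule left_orthogonal_retract[OF subsetD[OF perp B]])
    then show ?thesis by (rule conv)
  qed
  then have "thick_subcategory C L" using L unfolding thick_subcategory_def by blast
  moreover have "Hom C A B = {Zero C A B}" if "A \<in> L" "B \<in> N" for A B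
    using left_orthogonalD[of A C N] perp that Zero_in_Hom triangulated_subcategoryD(1)[OF N'] by blast
  ultimately show ?thesis using N tri unfolding complementary_def by blast
qed

end

section \<open>Contractible objects of an exact functor\<close>

lemma exact_functor_additive: "exact_functor C D G \<Longrightarrow> additive_functor C D G"
  by (simp add: exact_functor_def)

lemma I_contractible_ker_functor_iff:
  assumes F: "additive_functor T S F" and T: "category T"
  shows "A \<in> I_contractible T (ker_functor T S F) \<longleftrightarrow>
    A \<in> Obj T \<and> Ident S (fobj F A) = Zero S (fobj F A) (fobj F A)"
  using additive_functor_Ident[OF F] category.Id_in_Hom[OF T]
  by (auto simp: I_contractible_def ker_functor_def)

text \<open>Contractibility means that \<open>F\<close> sends the object to zero, a property
  inherited by retracts. The isomorphisms \<open>\<theta>\<close> carry it across suspension, and in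
  the image of a triangle with two such terms both maps at the cone vanish.\<close>

lemma I_contractible_ker_functor_thick:
  assumes T: "triangulated_category T" and S: "triangulated_category S" and F: "exact_functor T S F"
  shows "thick_subcategory T (I_contractible T (ker_functor T S F))"
proof -
  interpret T: triangulated_category T by (rule T)
  interpret S: triangulated_category S by (rule S)
  note F' = exact_functor_additive[OF F]
  note FHom = additive_functor_Hom[OF F'] and FObj = additive_functor_Obj[OF F']
    and FId = additive_functor_Ident[OF F'] and FComp = additive_functor_Comp[OF F']
  note FZero = additive_functor_Zero[OF T.preadditive_category_axioms S.preadditive_category_axioms F']
  let ?N = "I_contractible T (ker_functor T S F)"
  note N_iff = I_contractible_ker_functor_iff[OF F' T.category_axioms]
  obtain \<theta> where \<theta>: "\<And>A. A \<in> Obj T \<Longrightarrow> iso_arrow S (fobj F (\<Sigma>\<^sub>o T A)) (\<Sigma>\<^sub>o S (fobj F A)) (\<theta> A)"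
    and tri: "\<And>X Y Z f g h. exact_triangle T X Y Z f g h \<Longrightarrow>
      exact_triangle S (fobj F X) (fobj F Y) (fobj F Z) (farr F f) (farr F g) (\<theta> X \<cdot>\<^bsub>S\<^esub> farr F h)"
    using F unfolding exact_functor_def natural_iso_def func_comp_def by (auto simp: comp_def)
  have retract: "A \<in> ?N" if "B \<in> ?N" "j \<in> Hom T A B" "p \<in> Hom T B A" "p \<cdot>\<^bsub>T\<^esub> j = Ident T A" for A B j p
    using S.retract_of_zero[OF _ FHom[OF that(2)] FHom[OF that(3)]] FComp[OF that(2,3)] that
      FId T.Dom_Obj[OF that(2)] by (simp add: N_iff)
  have "triangulated_subcategory T ?N"
    unfolding triangulated_subcategory_def
  proof (intro conjI allI impI ballI)
    show "?N \<subseteq> Obj T" by (auto simp: I_contractible_def)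
    show "Z \<in> ?N" if "zero_object T Z" for Z
      using that FZero[of Z Z] FId[of Z] by (simp add: N_iff T.zero_object_iff)
    show "B \<in> ?N" if "A \<in> ?N \<and> iso_arrow T A B f" for A B f
    proof -
      have A: "A \<in> ?N" and f: "iso_arrow T A B f" using that by auto
      obtain g where "f \<in> Hom T A B" "g \<in> Hom T B A" "f \<cdot>\<^bsub>T\<^esub> g = Ident T B" using f by (rule T.iso_arrowE)
      then show ?thesis using retract[OF A] by blast
    qed
    fix A assume A: "A \<in> Obj T"
    obtain \<theta>' where th: "\<theta> A \<in> Hom S (fobj F (\<Sigma>\<^sub>o T A)) (\<Sigma>\<^sub>o S (fobj F A))"
      "\<theta>' \<in> Hom S (\<Sigma>\<^sub>o S (fobj F A)) (fobj F (\<Sigma>\<^sub>o T A))"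
      "\<theta>' \<cdot>\<^bsub>S\<^esub> \<theta> A = Ident S (fobj F (\<Sigma>\<^sub>o T A))" "\<theta> A \<cdot>\<^bsub>S\<^esub> \<theta>' = Ident S (\<Sigma>\<^sub>o S (fobj F A))"
      using \<theta>[OF A] by (rule S.iso_arrowE)
    have "\<Sigma>\<^sub>o T A \<in> ?N \<longleftrightarrow>
        Ident S (\<Sigma>\<^sub>o S (fobj F A)) = Zero S (\<Sigma>\<^sub>o S (fobj F A)) (\<Sigma>\<^sub>o S (fobj F A))"
      using S.retract_of_zero[OF _ th(1,2,3)] S.retract_of_zero[OF _ th(2,1,4)] T.Susp_Obj[OF A]
      by (auto simp: N_iff)
    then show "\<Sigma>\<^sub>o T A \<in> ?N \<longleftrightarrow> A \<in> ?N" using S.Susp_zero_iff[OF FObj[OF A]] A by (simp add: N_iff)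
  next
    fix X Y Z f g h assume *: "exact_triangle T X Y Z f g h \<and> X \<in> ?N \<and> Y \<in> ?N"
    then have t: "exact_triangle T X Y Z f g h" by simp
    note t' = tri[OF t]
    note H = S.triangle_Hom[OF t'] S.triangle_Obj[OF t']
    have g: "farr F g = Zero S (fobj F Y) (fobj F Z)"
      by (rule S.Hom_from_zero[OF _ H(2)]) (use * in \<open>simp add: N_iff\<close>)
    have h: "\<theta> X \<cdot>\<^bsub>S\<^esub> farr F h = Zero S (fobj F Z) (\<Sigma>\<^sub>o S (fobj F X))"
      by (rule S.Hom_to_zero[OF _ H(3)]) (use * S.Susp_zero_iff[OF H(4)] in \<open>simp add: N_iff\<close>)
    show "Z \<in> ?N" using S.cone_zero[OF t' g h] T.triangle_Obj(3)[OF t] by (simp add: N_iff)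
  qed
  moreover have "A \<in> ?N" if A: "A \<in> Obj T" "A' \<in> Obj T" and B: "B \<in> ?N"
    and j: "is_coproduct T (UNIV :: bool set) (\<lambda>b. if b then A else A') B j" for A A' B j
  proof -
    obtain p where "j True \<in> Hom T A B" "p \<in> Hom T B A" "p \<cdot>\<^bsub>T\<^esub> j True = Ident T A"
      by (rule T.coproduct_bool_retract[OF j A])
    then show ?thesis by (rule retract[OF B])
  qed
  ultimately show ?thesis unfolding thick_subcategory_def by blast
qed

section \<open>Adjunctions\<close>

locale additive_adjunction = S: preadditive_category S + T: preadditive_category T
  for S :: "('a, 'b, 'y) preadd_cat_scheme" and T :: "('c, 'd, 'z) preadd_cat_scheme" +
  fixes E :: "('a, 'b, 'c, 'd) func" and F :: "('c, 'd, 'a, 'b) func"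
    and \<phi> :: "'a \<Rightarrow> 'c \<Rightarrow> 'b \<Rightarrow> 'd"
  assumes E_additive: "additive_functor S T E" and F_additive: "additive_functor T S F"
    and adjunction: "adjunction S T E F \<phi>"
begin

lemmas E_simps = additive_functor_simps[OF E_additive]
lemmas F_simps = additive_functor_simps[OF F_additive]
lemmas E_Zero = additive_functor_Zero[OF S.preadditive_category_axioms T.preadditive_category_axioms E_additive]
lemmas F_Zero = additive_functor_Zero[OF T.preadditive_category_axioms S.preadditive_category_axioms F_additive]
lemmas F_Sub = additive_functor_Sub[OF T.preadditive_category_axioms S.preadditive_category_axioms F_additive]

definition counit :: "'c \<Rightarrow> 'd" where
  "counit B = \<phi> (fobj F B) B (Ident S (fobj F B))"

definition unit :: "'a \<Rightarrow> 'b" where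
  "unit A = inv_into (Hom S A (fobj F (fobj E A))) (\<phi> A (fobj E A)) (Ident T (fobj E A))"

lemma \<phi>_bij: "A \<in> Obj S \<Longrightarrow> B \<in> Obj T \<Longrightarrow> bij_betw (\<phi> A B) (Hom S A (fobj F B)) (Hom T (fobj E A) B)"
  using adjunction by (simp add: adjunction_def)

lemma \<phi>_natural:
  assumes "a \<in> Hom S A' A" "b \<in> Hom T B B'" "f \<in> Hom S A (fobj F B)"
  shows "\<phi> A' B' (farr F b \<cdot>\<^bsub>S\<^esub> f \<cdot>\<^bsub>S\<^esub> a) = b \<cdot>\<^bsub>T\<^esub> \<phi> A B f \<cdot>\<^bsub>T\<^esub> farr E a"
  using adjunction assms S.Dom_Obj S.Cod_Obj T.Dom_Obj T.Cod_Obj unfolding adjunction_def by meson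

lemma \<phi>_Hom: "f \<in> Hom S A (fobj F B) \<Longrightarrow> B \<in> Obj T \<Longrightarrow> \<phi> A B f \<in> Hom T (fobj E A) B"
  using \<phi>_bij S.Dom_Obj by (metis bij_betwE)

lemma counit_Hom:
  assumes "B \<in> Obj T" shows "counit B \<in> Hom T (fobj E (fobj F B)) B"
  unfolding counit_def by (intro \<phi>_Hom S.Id_in_Hom F_simps assms)

lemma unit_Hom_\<phi>:
  assumes A: "A \<in> Obj S"
  shows "unit A \<in> Hom S A (fobj F (fobj E A)) \<and> \<phi> A (fobj E A) (unit A) = Ident T (fobj E A)"
proof -
  have B: "fobj E A \<in> Obj T" using A by (rule E_simps)
  have "Ident T (fobj E A) \<in> \<phi> A (fobj E A) ` Hom S A (fobj F (fobj E A))"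
    using \<phi>_bij[OF A B] T.Id_in_Hom[OF B] by (simp add: bij_betw_def)
  from inv_into_into[OF this] f_inv_into_f[OF this] show ?thesis by (simp add: unit_def)
qed

lemmas unit_Hom = unit_Hom_\<phi>[THEN conjunct1]

text \<open>Naturality along \<open>f\<close>, applied to the identity of \<open>F B\<close>; from
  here on \<open>\<phi>\<close> enters only through the counit.\<close>

lemma \<phi>_eq:
  assumes f: "f \<in> Hom S A (fobj F B)" and B: "B \<in> Obj T"
  shows "\<phi> A B f = counit B \<cdot>\<^bsub>T\<^esub> farr E f"
proof -
  have FB: "fobj F B \<in> Obj S" using B by (rule F_simps)
  have Ef: "farr E f \<in> Hom T (fobj E A) (fobj E (fobj F B))" using f by (rule E_simps)
  show ?thesis
    using \<phi>_natural[OF f T.Id_in_Hom[OF B] S.Id_in_Hom[OF FB]] S.Comp_Id_left[OF f]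
      T.Comp_Id_left[OF T.Comp_in_Hom[OF Ef counit_Hom[OF B]]] F_simps(3)[OF B]
    by (simp add: counit_def)
qed

lemma counit_natural:
  assumes b: "b \<in> Hom T B B'"
  shows "b \<cdot>\<^bsub>T\<^esub> counit B = counit B' \<cdot>\<^bsub>T\<^esub> farr E (farr F b)"
proof -
  have B: "B \<in> Obj T" "B' \<in> Obj T" using b T.Dom_Obj T.Cod_Obj by auto
  have FB: "fobj F B \<in> Obj S" using B(1) by (rule F_simps)
  have Fb: "farr F b \<in> Hom S (fobj F B) (fobj F B')" using b by (rule F_simps)
  show ?thesis
    using \<phi>_natural[OF S.Id_in_Hom[OF FB] b S.Id_in_Hom[OF FB]] S.Comp_Id_left[OF S.Id_in_Hom[OF FB]]
      S.Comp_Id_right[OF Fb] \<phi>_eq[OF Fb B(2)] T.Comp_Id_right[OF counit_Hom[OF B(1)]] E_simps(3)[OF FB]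
    by (simp add: counit_def)
qed

text \<open>First triangle identity: the unit was chosen as the transpose of the identity.\<close>

lemma counit_E_unit:
  assumes A: "A \<in> Obj S"
  shows "counit (fobj E A) \<cdot>\<^bsub>T\<^esub> farr E (unit A) = Ident T (fobj E A)"
  using \<phi>_eq[OF unit_Hom[OF A] E_simps(2)[OF A]] unit_Hom_\<phi>[OF A] by simp

text \<open>Moves equations in \<open>S\<close> to their transposes in \<open>T\<close>, where
  naturality of the counit is available.\<close>

lemma \<phi>_inj:
  assumes f: "f \<in> Hom S A (fobj F B)" and g: "g \<in> Hom S A (fobj F B)" and B: "B \<in> Obj T"
    and eq: "counit B \<cdot>\<^bsub>T\<^esub> farr E f = counit B \<cdot>\<^bsub>T\<^esub> farr E g"
  shows "f = g"
  using \<phi>_bij[OF S.Dom_Obj[OF f] B] eq \<phi>_eq[OF f B] \<phi>_eq[OF g B] f g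
  unfolding bij_betw_def inj_on_def by simp

text \<open>Second triangle identity. It exhibits \<open>F\<close> of the counit as a split
  epimorphism, which drives both the contraction of the resolution and the construction of the
  approximating triangles.\<close>

lemma F_counit_unit:
  assumes B: "B \<in> Obj T"
  shows "farr F (counit B) \<cdot>\<^bsub>S\<^esub> unit (fobj F B) = Ident S (fobj F B)"
proof (rule \<phi>_inj[OF _ _ B])
  have FB: "fobj F B \<in> Obj S" using B by (rule F_simps)
  note c = counit_Hom[OF B] and u = unit_Hom[OF FB]
  note Fc = F_simps(1)[OF c] and Eu = E_simps(1)[OF u]
  note c' = counit_Hom[OF T.Dom_Obj[OF c]]
  show "farr F (counit B) \<cdot>\<^bsub>S\<^esub> unit (fobj F B) \<in> Hom S (fobj F B) (fobj F B)"
    using u Fc by (rule S.Comp_in_Hom)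
  show "Ident S (fobj F B) \<in> Hom S (fobj F B) (fobj F B)" using FB by (rule S.Id_in_Hom)
  have "counit B \<cdot>\<^bsub>T\<^esub> farr E (farr F (counit B) \<cdot>\<^bsub>S\<^esub> unit (fobj F B)) =
      (counit B \<cdot>\<^bsub>T\<^esub> farr E (farr F (counit B))) \<cdot>\<^bsub>T\<^esub> farr E (unit (fobj F B))"
    using E_simps(4)[OF u Fc] T.Comp_assoc[OF Eu E_simps(1)[OF Fc] c] by simp
  also have "\<dots> = counit B \<cdot>\<^bsub>T\<^esub> (counit (fobj E (fobj F B)) \<cdot>\<^bsub>T\<^esub> farr E (unit (fobj F B)))"
    using counit_natural[OF c, symmetric] T.Comp_assoc[OF Eu c' c] by simp
  finally show "counit B \<cdot>\<^bsub>T\<^esub> farr E (farr F (counit B) \<cdot>\<^bsub>S\<^esub> unit (fobj F B)) =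
      counit B \<cdot>\<^bsub>T\<^esub> farr E (Ident S (fobj F B))"
    using counit_E_unit[OF FB] E_simps(3)[OF FB] by simp
qed

lemma unit_natural:
  assumes a: "a \<in> Hom S A' A"
  shows "farr F (farr E a) \<cdot>\<^bsub>S\<^esub> unit A' = unit A \<cdot>\<^bsub>S\<^esub> a"
proof -
  have A: "A \<in> Obj S" "A' \<in> Obj S" using a S.Dom_Obj S.Cod_Obj by auto
  note EA = E_simps(2)[OF A(1)]
  note Ea = E_simps(1)[OF a] and u = unit_Hom[OF A(1)] and u' = unit_Hom[OF A(2)]
  note FEa = F_simps(1)[OF Ea] and c = counit_Hom[OF EA] and c' = counit_Hom[OF E_simps(2)[OF A(2)]]
  show ?thesis
  proof (rule \<phi>_inj[OF S.Comp_in_Hom[OF u' FEa] S.Comp_in_Hom[OF a u] EA])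
    have "counit (fobj E A) \<cdot>\<^bsub>T\<^esub> farr E (farr F (farr E a) \<cdot>\<^bsub>S\<^esub> unit A') =
        (counit (fobj E A) \<cdot>\<^bsub>T\<^esub> farr E (farr F (farr E a))) \<cdot>\<^bsub>T\<^esub> farr E (unit A')"
      using E_simps(4)[OF u' FEa] T.Comp_assoc[OF E_simps(1)[OF u'] E_simps(1)[OF FEa] c] by simp
    also have "\<dots> = farr E a \<cdot>\<^bsub>T\<^esub> (counit (fobj E A') \<cdot>\<^bsub>T\<^esub> farr E (unit A'))"
      using counit_natural[OF Ea, symmetric] T.Comp_assoc[OF E_simps(1)[OF u'] c' Ea] by simp
    also have "\<dots> = farr E a"
      using counit_E_unit[OF A(2)] T.Comp_Id_right[OF Ea] by simp
    also have "\<dots> = (counit (fobj E A) \<cdot>\<^bsub>T\<^esub> farr E (unit A)) \<cdot>\<^bsub>T\<^esub> farr E a"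
      using counit_E_unit[OF A(1)] T.Comp_Id_left[OF Ea] by simp
    also have "\<dots> = counit (fobj E A) \<cdot>\<^bsub>T\<^esub> farr E (unit A \<cdot>\<^bsub>S\<^esub> a)"
      using E_simps(4)[OF a u] T.Comp_assoc[OF Ea E_simps(1)[OF u] c] by simp
    finally show "counit (fobj E A) \<cdot>\<^bsub>T\<^esub> farr E (farr F (farr E a) \<cdot>\<^bsub>S\<^esub> unit A') =
        counit (fobj E A) \<cdot>\<^bsub>T\<^esub> farr E (unit A \<cdot>\<^bsub>S\<^esub> a)" .
  qed
qed

text \<open>By the first triangle identity and naturality, \<open>f\<close> is the composite of the
  counit, \<open>E (F f)\<close> and \<open>E\<close> of the unit, so it is recovered from
  \<open>F f\<close>. Projectivity and orthogonality of the objects \<open>E A\<close> both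
  follow.\<close>

lemma zero_if_F_zero:
  assumes A: "A \<in> Obj S" and f: "f \<in> Hom T (fobj E A) B"
    and Ff: "farr F f = Zero S (fobj F (fobj E A)) (fobj F B)"
  shows "f = Zero T (fobj E A) B"
proof -
  note EA = E_simps(2)[OF A]
  have B: "B \<in> Obj T" using f by (rule T.Cod_Obj)
  note Eu = E_simps(1)[OF unit_Hom[OF A]] and c = counit_Hom[OF EA] and cB = counit_Hom[OF B]
  have "f = f \<cdot>\<^bsub>T\<^esub> (counit (fobj E A) \<cdot>\<^bsub>T\<^esub> farr E (unit A))"
    using counit_E_unit[OF A] T.Comp_Id_right[OF f] by simp
  also have "\<dots> = (counit B \<cdot>\<^bsub>T\<^esub> farr E (farr F f)) \<cdot>\<^bsub>T\<^esub> farr E (unit A)"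
    using T.Comp_assoc[OF Eu c f] counit_natural[OF f] by simp
  also have "farr E (farr F f) = Zero T (fobj E (fobj F (fobj E A))) (fobj E (fobj F B))"
    using Ff E_Zero F_simps(2) EA B by simp
  finally show ?thesis
    using T.Comp_Zero_right[OF cB T.Cod_Obj[OF Eu]] T.Comp_Zero_left[OF Eu B] by simp
qed

lemma E_projective:
  assumes A: "A \<in> Obj S"
  shows "I_projective T (ker_functor T S F) (fobj E A)"
proof -
  have "ker_functor T S F (fobj E A) B = {Zero T (fobj E A) B}" if B: "B \<in> Obj T" for B
  proof
    show "ker_functor T S F (fobj E A) B \<subseteq> {Zero T (fobj E A) B}"
      unfolding ker_functor_def by (blast intro: zero_if_F_zero[OF A])
    show "{Zero T (fobj E A) B} \<subseteq> ker_functor T S F (fobj E A) B"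
      using T.Zero_in_Hom[OF E_simps(2)[OF A] B] F_Zero[OF E_simps(2)[OF A] B]
      by (simp add: ker_functor_def)
  qed
  then show ?thesis using E_simps(2)[OF A] by (simp add: I_projective_def)
qed

text \<open>The bar resolution of the comonad \<open>L = E F\<close>: the alternating sum of the face maps
  satisfies the recursion \<open>\<delta> (n + 1) = counit - L (\<delta> n)\<close>.\<close>

lemma bar_resolution:
  assumes A: "A \<in> Obj T"
  shows "\<exists>\<delta>. ker_projective_resolution T S F A (\<lambda>n. (fobj (func_comp E F) ^^ (n + 1)) A) \<delta>"
proof -
  \<comment> \<open>The augmented complex, with \<open>A\<close> in position 0, so that the
    differentials obey one uniform recursion.\<close>
  define X where "X n = (fobj (func_comp E F) ^^ n) A" for n
  have X_simps: "X 0 = A" "X (Suc n) = fobj E (fobj F (X n))" for n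
    by (simp_all add: X_def func_comp_def)
  have XO: "X n \<in> Obj T" for n by (induction n) (simp_all add: X_simps A E_simps F_simps)
  have FXO: "fobj F (X n) \<in> Obj S" for n using XO by (rule F_simps)
  have P: "case_nat A (\<lambda>n. X (Suc n)) = X"
    by (rule ext) (simp add: X_simps(1) split: nat.split)
  \<comment> \<open>Unrolled, \<open>\<delta> n\<close> is the sum over \<open>k \<le> n\<close> of
    \<open>(-1)^k\<close> times \<open>L^k\<close> applied to the counit at
    \<open>X (n - k)\<close>.\<close>
  define \<delta> where "\<delta> = rec_nat (counit A) (\<lambda>n d. counit (X (Suc n)) \<ominus>\<^bsub>T\<^esub> farr E (farr F d))"
  have \<delta>_simps: "\<delta> 0 = counit A" "\<delta> (Suc n) = counit (X (Suc n)) \<ominus>\<^bsub>T\<^esub> farr E (farr F (\<delta> n))" for n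
    by (simp_all add: \<delta>_def)
  have c: "counit (X n) \<in> Hom T (X (Suc n)) (X n)" for n
    using counit_Hom[OF XO] by (simp add: X_simps)
  have \<delta>: "\<delta> n \<in> Hom T (X (Suc n)) (X n)" for n
  proof (induction n)
    case 0
    then show ?case using c[of 0] by (simp add: \<delta>_simps X_simps)
  next
    case (Suc n)
    have "farr E (farr F (\<delta> n)) \<in> Hom T (X (Suc (Suc n))) (X (Suc n))"
      using E_simps(1)[OF F_simps(1)[OF Suc]] by (simp add: X_simps)
    then show ?case using T.Sub_in_Hom[OF c] by (simp add: \<delta>_simps)
  qed
  have L\<delta>: "farr E (farr F (\<delta> n)) \<in> Hom T (X (Suc (Suc n))) (X (Suc n))" for n
    using E_simps(1)[OF F_simps(1)[OF \<delta>]] by (simp add: X_simps)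
  have nat: "\<delta> n \<cdot>\<^bsub>T\<^esub> counit (X (Suc n)) = counit (X n) \<cdot>\<^bsub>T\<^esub> farr E (farr F (\<delta> n))" for n
    by (rule counit_natural[OF \<delta>])
  \<comment> \<open>Naturality of the counit lets \<open>L (\<delta> n)\<close> be factored out on
    the right. By the recursion the other factor is zero for \<open>n = 0\<close> and otherwise
    \<open>L\<close> of the previous differential, so \<open>\<delta> \<cdot> \<delta> = 0\<close>
    propagates by applying \<open>L\<close>.\<close>
  have \<delta>\<delta>: "\<delta> n \<cdot>\<^bsub>T\<^esub> \<delta> (Suc n) = (counit (X n) \<ominus>\<^bsub>T\<^esub> \<delta> n) \<cdot>\<^bsub>T\<^esub> farr E (farr F (\<delta> n))" for n
    using T.Comp_Sub_right[OF c L\<delta> \<delta>] T.Comp_Sub_left[OF L\<delta> c \<delta>] nat by (simp add: \<delta>_simps(2))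
  have LZero: "farr E (farr F (Zero T (X m) (X n))) = Zero T (X (Suc m)) (X (Suc n))" for m n
    using F_Zero[OF XO XO] E_Zero[OF FXO FXO] by (simp add: X_simps(2))
  have zero: "\<delta> n \<cdot>\<^bsub>T\<^esub> \<delta> (Suc n) = Zero T (X (Suc (Suc n))) (X n)" for n
  proof (induction n)
    case 0
    have "counit (X 0) \<ominus>\<^bsub>T\<^esub> \<delta> 0 = Zero T (X (Suc 0)) (X 0)"
      using T.Sub_self[OF c[of 0]] by (simp add: \<delta>_simps X_simps(1))
    then show ?case using \<delta>\<delta>[of 0] T.Comp_Zero_left[OF L\<delta> XO] by simp
  next
    case (Suc n)
    have "counit (X (Suc n)) \<ominus>\<^bsub>T\<^esub> \<delta> (Suc n) = farr E (farr F (\<delta> n))"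
      using T.Sub_Sub_cancel[OF c L\<delta>] by (simp add: \<delta>_simps(2))
    then have "\<delta> (Suc n) \<cdot>\<^bsub>T\<^esub> \<delta> (Suc (Suc n)) = farr E (farr F (\<delta> n)) \<cdot>\<^bsub>T\<^esub> farr E (farr F (\<delta> (Suc n)))"
      using \<delta>\<delta>[of "Suc n"] by simp
    also have "\<dots> = farr E (farr F (\<delta> n \<cdot>\<^bsub>T\<^esub> \<delta> (Suc n)))"
      using F_simps(4)[OF \<delta> \<delta>] E_simps(4)[OF F_simps(1)[OF \<delta>] F_simps(1)[OF \<delta>]] by simp
    finally show ?case using Suc LZero by simp
  qed
  have complex: "chain_complex T X \<delta>" using XO \<delta> zero by (simp add: chain_complex_def)
  have "chain_complex S (\<lambda>n. fobj F (X n)) (\<lambda>n. farr F (\<delta> n))"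
    unfolding chain_complex_def
    using FXO F_simps(1)[OF \<delta>] F_simps(4)[OF \<delta> \<delta>] zero F_Zero[OF XO XO] by metis
  \<comment> \<open>The extra degeneracy of the bar construction, which exists only after applying
    \<open>F\<close>.\<close>
  moreover define s where "s n = unit (fobj F (X n))" for n
  have s: "s n \<in> Hom S (fobj F (X n)) (fobj F (X (Suc n)))" for n
    using unit_Hom[OF FXO] by (simp add: s_def X_simps)
  have Fc_s: "farr F (counit (X n)) \<cdot>\<^bsub>S\<^esub> s n = Ident S (fobj F (X n))" for n
    using F_counit_unit[OF XO] by (simp add: s_def)
  have "farr F (\<delta> 0) \<cdot>\<^bsub>S\<^esub> s 0 = Ident S (fobj F (X 0))"
    using Fc_s[of 0] by (simp add: \<delta>_simps X_simps(1))
  moreover have "(farr F (\<delta> (Suc n)) \<cdot>\<^bsub>S\<^esub> s (Suc n)) \<oplus>\<^bsub>S\<^esub> (s n \<cdot>\<^bsub>S\<^esub> farr F (\<delta> n)) = Ident S (fobj F (X (Suc n)))"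
    for n
  proof -
    \<comment> \<open>Naturality of the unit identifies the recursive part of the next differential,
      composed with \<open>s\<close>, with the other term of the homotopy identity; the counit part
      contributes the identity.\<close>
    have "farr F (farr E (farr F (\<delta> n))) \<cdot>\<^bsub>S\<^esub> s (Suc n) = s n \<cdot>\<^bsub>S\<^esub> farr F (\<delta> n)"
      using unit_natural[OF F_simps(1)[OF \<delta>]] by (simp add: s_def)
    then have "farr F (\<delta> (Suc n)) \<cdot>\<^bsub>S\<^esub> s (Suc n) = Ident S (fobj F (X (Suc n))) \<ominus>\<^bsub>S\<^esub> s n \<cdot>\<^bsub>S\<^esub> farr F (\<delta> n)"
      using F_Sub[OF c L\<delta>] S.Comp_Sub_left[OF s F_simps(1)[OF c] F_simps(1)[OF L\<delta>]] Fc_s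
      by (simp add: \<delta>_simps(2))
    then show ?thesis
      using S.Sub_Add_cancel[OF S.Id_in_Hom[OF FXO] S.Comp_in_Hom[OF F_simps(1)[OF \<delta>] s]] by simp
  qed
  ultimately have "split_exact S (\<lambda>n. fobj F (X n)) (\<lambda>n. farr F (\<delta> n))"
    using s unfolding split_exact_def by blast
  moreover have "I_projective T (ker_functor T S F) (X (Suc n))" for n
    using E_projective[OF FXO] by (simp add: X_simps)
  ultimately have "ker_projective_resolution T S F A (\<lambda>n. X (Suc n)) \<delta>"
    using complex unfolding ker_projective_resolution_def P by blast
  then show ?thesis by (auto simp: X_def)
qed

end

section \<open>The complementary pair\<close>

theorem proposition2p1:
  fixes S :: "('a, 'b) tri_cat"
    and T :: "('c, 'd) tri_cat"
    and E :: "('a, 'b, 'c, 'd) func"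
    and F :: "('c, 'd, 'a, 'b) func"
    and \<phi> :: "'a \<Rightarrow> 'c \<Rightarrow> 'b \<Rightarrow> 'd"
  assumes "triangulated_category S" and "has_countable_sums S"
    and "triangulated_category T" and "has_countable_sums T"
    and "exact_functor S T E" and "preserves_countable_sums S T E"
    and "exact_functor T S F" and "preserves_countable_sums T S F"
    and "adjunction S T E F \<phi>"
  shows "(\<forall>A \<in> Obj T. \<exists>\<delta>.
            ker_projective_resolution T S F A
              (\<lambda>n. (fobj (func_comp E F) ^^ (n + 1)) A) \<delta>) \<and>
         complementary T (localizing_generated T (fobj E ` Obj S))
           (I_contractible T (ker_functor T S F))"
proof -
  interpret S: triangulated_category S by fact
  interpret T: triangulated_category T by fact
  note E = exact_functor_additive[OF assms(5)] and F = exact_functor_additive[OF assms(7)]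
  interpret additive_adjunction S T E F \<phi>
    by unfold_locales (use E F assms(9) in blast)+
  let ?N = "I_contractible T (ker_functor T S F)" and ?K = "localizing_generated T (fobj E ` Obj S)"
  have thick: "thick_subcategory T ?N"
    by (rule I_contractible_ker_functor_thick[OF assms(3,1,7)])
  then have N: "triangulated_subcategory T ?N" by (simp add: thick_subcategory_def)
  note N_iff = I_contractible_ker_functor_iff[OF F T.category_axioms]
  have "fobj E X \<in> left_orthogonal T ?N" if X: "X \<in> Obj S" for X
  proof (rule left_orthogonalI[OF E_simps(2)[OF X]])
    fix B f assume B: "B \<in> ?N" and f: "f \<in> Hom T (fobj E X) B"
    have "Ident S (fobj F B) = Zero S (fobj F B) (fobj F B)" using B by (simp add: N_iff)
    then show "f = Zero T (fobj E X) B"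
      by (intro zero_if_F_zero[OF X f] S.Hom_to_zero[OF _ F_simps(1)[OF f]])
  qed
  then have perp: "fobj E ` Obj S \<subseteq> left_orthogonal T ?N" by blast
  \<comment> \<open>This left orthogonal serves twice: as a member of the family whose intersection
    is \<open>?K\<close>, and as an upper bound for \<open>?K\<close>.\<close>
  note loc = T.left_orthogonal_localizing[OF N]
  have K: "localizing_subcategory T ?K" by (rule localizing_generated_localizing[OF loc perp])
  note K' = localizing_subcategoryD(1)[OF K]
  have K_perp: "?K \<subseteq> left_orthogonal T ?N"
    unfolding localizing_generated_def using loc perp by (intro Inter_lower) simp
  have E_K: "fobj E X \<in> ?K" if "X \<in> Obj S" for X
    unfolding localizing_generated_def using that by blast
  have "\<exists>B' \<iota> h. exact_triangle T (fobj E (fobj F B)) B B' (counit B) \<iota> h" if "B \<in> Obj T" for B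
    using T.triangle_exists[OF counit_Hom[OF that]] .
  then obtain c \<iota> h where c: "\<And>B. B \<in> Obj T \<Longrightarrow>
      exact_triangle T (fobj E (fobj F B)) B (c B) (counit B) (\<iota> B) (h B)"
    by metis
  have F_\<iota>: "farr F (\<iota> B) = Zero S (fobj F B) (fobj F (c B))" if B: "B \<in> Obj T" for B
  proof -
    note \<iota> = T.triangle_Hom(2)[OF c[OF B]] and FB = F_simps(2)[OF B]
    note Fc = F_simps(1)[OF counit_Hom[OF B]] and u = unit_Hom[OF FB]
    have "farr F (\<iota> B) = (farr F (\<iota> B) \<cdot>\<^bsub>S\<^esub> farr F (counit B)) \<cdot>\<^bsub>S\<^esub> unit (fobj F B)"
      using S.Comp_assoc[OF u Fc F_simps(1)[OF \<iota>]] F_counit_unit[OF B]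
        S.Comp_Id_right[OF F_simps(1)[OF \<iota>]] by simp
    also have "farr F (\<iota> B) \<cdot>\<^bsub>S\<^esub> farr F (counit B) =
        Zero S (fobj F (fobj E (fobj F B))) (fobj F (c B))"
      using F_simps(4)[OF counit_Hom[OF B] \<iota>] T.triangle_comp_zero[OF c[OF B]]
        F_Zero[OF T.triangle_Obj(1,3)[OF c[OF B]]] by simp
    finally show ?thesis
      using S.Comp_Zero_left[OF u F_simps(2)[OF T.triangle_Obj(3)[OF c[OF B]]]] by simp
  qed
  have triangle: "\<exists>P\<in>?K. \<exists>Q\<in>?N. \<exists>f g h. exact_triangle T P A Q f g h" if A: "A \<in> Obj T" for A
  proof -
    define N where "N n = (c ^^ n) A" for n
    have N_simps: "N 0 = A" "N (Suc n) = c (N n)" for n by (simp_all add: N_def)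
    have NO: "N n \<in> Obj T" for n
      by (induction n) (simp_all add: N_simps A T.triangle_Obj(3)[OF c])
    have \<iota>: "\<iota> (N n) \<in> Hom T (N n) (N (Suc n))" for n
      using T.triangle_Hom(2)[OF c[OF NO]] by (simp add: N_simps)
    \<comment> \<open>Rotating the triangle of the counit shows that the cone of
      \<open>\<iota> (N n)\<close> is the suspension of \<open>E (F (N n))\<close>.\<close>
    have cone: "T.cone_in ?K (N n) (N (Suc n)) (\<iota> (N n))" for n
    proof -
      have "fobj E (fobj F (N n)) \<in> ?K" using E_K F_simps(2)[OF NO] by blast
      then have "\<Sigma>\<^sub>o T (fobj E (fobj F (N n))) \<in> ?K"
        using triangulated_subcategoryD(4)[OF K' T.triangle_Obj(1)[OF c[OF NO]]] by simp
      then show ?thesis using T.rotate[OF c[OF NO]] unfolding T.cone_in_def N_simps by blast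
    qed
    obtain Y j t M g h f where Y: "is_coproduct T (UNIV :: nat set) N Y j"
      and t: "t \<in> Hom T Y Y" "\<And>k. t \<cdot>\<^bsub>T\<^esub> j k = j k \<ominus>\<^bsub>T\<^esub> j (Suc k) \<cdot>\<^bsub>T\<^esub> \<iota> (N k)"
      and M: "exact_triangle T Y Y M t g h" and f: "T.cone_in ?K (N 0) M f"
      using T.telescope[OF assms(4) K, of N "\<lambda>n. \<iota> (N n)", OF cone] by blast
    have j: "j k \<in> Hom T (N k) Y" for k using T.coproduct_in_Hom[OF Y] by simp
    have YO: "Y \<in> Obj T" using t(1) by (rule T.Dom_Obj)
    have FY: "is_coproduct S (UNIV :: nat set) (\<lambda>k. fobj F (N k)) (fobj F Y) (\<lambda>k. farr F (j k))"
      using assms(8) Y NO by (simp add: preserves_countable_sums_def)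
    \<comment> \<open>\<open>F\<close> preserves the sum, and on each summand it kills the shift
      term of \<open>t\<close>; only the identity is left.\<close>
    have Ft: "farr F t = Ident S (fobj F Y)"
    proof (rule S.coproduct_eqI[OF FY F_simps(1)[OF t(1)] S.Id_in_Hom[OF F_simps(2)[OF YO]]])
      fix k
      note j\<iota> = T.Comp_in_Hom[OF \<iota> j]
      have "farr F (j (Suc k) \<cdot>\<^bsub>T\<^esub> \<iota> (N k)) = Zero S (fobj F (N k)) (fobj F Y)"
        using F_simps(4)[OF \<iota> j] F_\<iota>[OF NO]
          S.Comp_Zero_right[OF F_simps(1)[OF j[of "Suc k"]] F_simps(2)[OF NO]]
        by (simp add: N_simps)
      then have "farr F (t \<cdot>\<^bsub>T\<^esub> j k) = farr F (j k)"
        using F_Sub[OF j j\<iota>] S.Sub_Zero[OF F_simps(1)[OF j]] by (simp add: t(2))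
      then show "farr F t \<cdot>\<^bsub>S\<^esub> farr F (j k) = Ident S (fobj F Y) \<cdot>\<^bsub>S\<^esub> farr F (j k)"
        using F_simps(4)[OF j t(1)] S.Comp_Id_left[OF F_simps(1)[OF j]] by simp
    qed
    obtain g' h' where "exact_triangle S (fobj F Y) (fobj F Y) (fobj F M) (farr F t) g' h'"
      using assms(7) M unfolding exact_functor_def by blast
    then have MN: "M \<in> ?N"
      using S.cone_Ident_zero T.triangle_Obj(3)[OF M] unfolding Ft N_iff by blast
    obtain Q g h where Q: "Q \<in> ?K" "exact_triangle T A M Q f g h"
      using f unfolding T.cone_in_def N_simps by blast
    \<comment> \<open>The telescope yields \<open>A \<rightarrow> M\<close> with cone in
      \<open>?K\<close>; the fibre turns this into a triangle starting in \<open>?K\<close> and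
      ending in \<open>M\<close>.\<close>
    show ?thesis using T.triangle_fibre[OF K' Q(2,1)] MN by blast
  qed
  show ?thesis using bar_resolution T.complementaryI[OF K' thick K_perp triangle] by blast
qed

end
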